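(* Let $\lambda\in\mathcal{SP}_n$ (a strict partition of $n$) and $\mu\in\mathcal{OP}_n$ (a partition of $n$ into odd parts). Then the character value $\zeta^\lambda_\mu(q)$ is a symmetric polynomial in $q$, i.e. $\zeta^\lambda_\mu(q)\in\mathbb Z[q]$ and there exists $m\in\mathbb Z$ such that $\zeta^\lambda_\mu(q)=q^m\zeta^\lambda_\mu(q^{-1})$.
   Context: Here a polynomial $f(x)\in\mathbb Z[x]$ is called symmetric if there is $m\in\mathbb Z$ with $f(x)=x^mf(x^{-1})$. Partitions: $l(\lambda)$ is the number of nonzero parts; $\delta(\lambda)\in\{0,1\}$ is the parity of $l(\lambda)$; $\epsilon(\lambda)=\lfloor l(\lambda)/2\rfloor$; $z_\lambda=\prod_{i\ge1}i^{m_i}m_i!$ with $m_i$ the multiplicity of $i$ in $\lambda$. Ring and form: $\Gamma=\mathbb{Q}(q)[p_1,p_3,p_5,\dots]$ is generated by the odd power sums, with the bilinear form $\langle p_\lambda,p_\mu\rangle=2^{-l(\lambda)}z_\lambda\delta_{\lambda\mu}$ for odd partitions $\lambda,\mu$. Operators $Q_n$ ($n\in\mathbb Z$) on $\Gamma$ are defined by $\sum_{n}Q_nz^n=\exp\big(\sum_{n\ge1,\,\mathrm{odd}}\frac2n p_nz^n\big)\exp\big(-\sum_{n\ge1,\,\mathrm{odd}}\frac{\partial}{\partial p_n}z^{-n}\big)$, and for strict $\lambda=(\lambda_1,\dots,\lambda_l)$, $Q_\lambda=Q_{\lambda_1}\cdots Q_{\lambda_l}.1$ is Schur's $Q$-function;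 $\langle Q_\lambda,Q_\mu\rangle=2^{l(\lambda)}\delta_{\lambda\mu}$. Characters: define $g_n\in\Gamma$ by $\sum_{n\ge0}g_nz^n=\exp\big(\sum_{n\ge1,\,\mathrm{odd}}\frac{2(q^n-1)}{n}p_nz^n\big)$, and $g_\mu=g_{\mu_1}g_{\mu_2}\cdots$. The number $\zeta^\lambda_\mu(q)$ is the value of the irreducible character of the Hecke-Clifford algebra $\mathcal H^c_n$ labelled by $\lambda$ at the standard element $T_{\gamma_\mu}$; it is determined by the Frobenius formula $\frac{g_\mu}{(q-1)^{l(\mu)}}=\sum_{\lambda\in\mathcal{SP}_n}2^{-\frac{l(\lambda)+\delta(\lambda)}2}\zeta^\lambda_\mu(q)Q_\lambda$, equivalently $\zeta^\lambda_\mu(q)=2^{-\epsilon(\lambda)}(q-1)^{-l(\mu)}\langle g_\mu,Q_\lambda\rangle$, which may be taken as its definition. *)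

theory Defs
  imports
    "HOL-Computational_Algebra.Computational_Algebra"
    "HOL-Library.Poly_Mapping"
    "HOL-Library.Multiset"
begin

section \<open>Partitions\<close>

text \<open>Partitions are lists of their nonzero parts in weakly decreasing order.\<close>

definition strict_partitions :: "nat \<Rightarrow> nat list set" where
  "strict_partitions n = {ps. sorted_wrt (>) ps \<and> 0 \<notin> set ps \<and> sum_list ps = n}"

definition odd_partitions :: "nat \<Rightarrow> nat list set" where
  "odd_partitions n = {ps. sorted_wrt (\<ge>) ps \<and> (\<forall>i\<in>set ps. odd i) \<and> sum_list ps = n}"

definition z_part :: "nat list \<Rightarrow> nat" where
  "z_part ps = (\<Prod>i\<in>set ps. i ^ count_list ps i * fact (count_list ps i))"

definition eps_part :: "nat list \<Rightarrow> nat" where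
  "eps_part ps = length ps div 2"


section \<open>The ring \<open>\<Gamma>\<close>\<close>

text \<open>The field \<open>\<rat>(q)\<close> and its generator.\<close>

type_synonym ratfun = "rat poly fract"

definition qvar :: ratfun where
  "qvar = Fraction_Field.Fract [:0, 1:] 1"

text \<open>
  \<open>\<Gamma> = \<rat>(q)[p\<^sub>1, p\<^sub>3, p\<^sub>5, \<dots>]\<close>: a monomial is a finitely supported exponent function, whose
  value at index \<open>k\<close> is the exponent of \<open>p\<^bsub>2k+1\<^esub>\<close>.
\<close>

type_synonym monom_idx = "nat \<Rightarrow>\<^sub>0 nat"
type_synonym Gam = "monom_idx \<Rightarrow>\<^sub>0 ratfun"

definition Gam_const :: "ratfun \<Rightarrow> Gam" where
  "Gam_const c = Poly_Mapping.single 0 c"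

text \<open>Used for odd \<open>n\<close> only.\<close>

definition psum :: "nat \<Rightarrow> Gam" where
  "psum n = Poly_Mapping.single (Poly_Mapping.single (n div 2) 1) 1"

definition p_part :: "nat list \<Rightarrow> Gam" where
  "p_part ps = prod_list (map psum ps)"

text \<open>The partial derivative with respect to \<open>psum n\<close>, for odd \<open>n\<close>.\<close>

definition deriv_p :: "nat \<Rightarrow> Gam \<Rightarrow> Gam" where
  "deriv_p n f = (\<Sum>m\<in>Poly_Mapping.keys f.
     Poly_Mapping.single (m - Poly_Mapping.single (n div 2) 1)
       (of_nat (Poly_Mapping.lookup m (n div 2)) * Poly_Mapping.lookup f m))"

text \<open>
  The monomials are the \<open>p\<^sub>\<lambda>\<close> for \<open>\<lambda>\<close> a partition into odd parts, where the exponents are the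
  multiplicities of the parts. The form is the bilinear extension of
  \<open>\<langle>p\<^sub>\<lambda>, p\<^sub>\<mu>\<rangle> = 2\<^bsup>-l(\<lambda>)\<^esup> z\<^sub>\<lambda> \<delta>\<^bsub>\<lambda>\<mu>\<^esub>\<close>, see \<open>Gam_form_p_part\<close> below.
\<close>

definition monom_length :: "monom_idx \<Rightarrow> nat" where
  "monom_length m = (\<Sum>k\<in>Poly_Mapping.keys m. Poly_Mapping.lookup m k)"

definition monom_z :: "monom_idx \<Rightarrow> nat" where
  "monom_z m = (\<Prod>k\<in>Poly_Mapping.keys m.
     (2 * k + 1) ^ Poly_Mapping.lookup m k * fact (Poly_Mapping.lookup m k))"

definition Gam_form :: "Gam \<Rightarrow> Gam \<Rightarrow> ratfun" where
  "Gam_form f g = (\<Sum>m\<in>Poly_Mapping.keys f.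
     Poly_Mapping.lookup f m * Poly_Mapping.lookup g m * (of_nat (monom_z m) / 2 ^ monom_length m))"


section \<open>The vertex operators and Schur's \<open>Q\<close>-functions\<close>

text \<open>The exponential of a power series over \<open>\<Gamma>\<close> with zero constant term.\<close>

definition Gam_exp :: "Gam fps \<Rightarrow> Gam fps" where
  "Gam_exp F = Abs_fps (\<lambda>k. Gam_const (1 / of_nat (fact k))) oo F"

definition creation :: "Gam fps" where
  "creation = Gam_exp (Abs_fps (\<lambda>n. if odd n then Gam_const (2 / of_nat n) * psum n else 0))"

text \<open>
  The operator \<open>- (\<Sum>n odd. w\<^sup>n \<partial>/\<partial>p\<^sub>n)\<close> on \<open>\<Gamma>[[w]]\<close>, where \<open>w\<close> stands for \<open>z\<^bsup>-1\<^esup>\<close>, and its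
  exponential applied to an element of \<open>\<Gamma>\<close>. The operator raises the order in \<open>w\<close>, so that
  only the powers up to the \<open>j\<close>-th contribute to the coefficient of \<open>w\<^sup>j\<close>.
\<close>

definition annihilation_log :: "Gam fps \<Rightarrow> Gam fps" where
  "annihilation_log F =
     Abs_fps (\<lambda>j. - (\<Sum>n\<in>{n. odd n \<and> n \<le> j}. deriv_p n (fps_nth F (j - n))))"

definition annihilation :: "Gam \<Rightarrow> Gam fps" where
  "annihilation f =
     Abs_fps (\<lambda>j. \<Sum>k\<le>j. Gam_const (1 / of_nat (fact k)) *
       fps_nth ((annihilation_log ^^ k) (fps_const f)) j)"

text \<open>
  \<open>Qop n f\<close> is the coefficient of \<open>z\<^sup>n\<close> in the product of \<open>creation\<close> (a series in \<open>z\<close>) and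
  \<open>annihilation f\<close> (a polynomial in \<open>z\<^bsup>-1\<^esup>\<close>, by \<open>finite_annihilation\<close> below).
\<close>

definition Qop :: "int \<Rightarrow> Gam \<Rightarrow> Gam" where
  "Qop n f = (\<Sum>j\<in>{j. fps_nth (annihilation f) j \<noteq> 0 \<and> n + int j \<ge> 0}.
     fps_nth creation (nat (n + int j)) * fps_nth (annihilation f) j)"

definition Qfun :: "nat list \<Rightarrow> Gam" where
  "Qfun ps = foldr (\<lambda>i. Qop (int i)) ps 1"


section \<open>Character values of the Hecke-Clifford algebra\<close>

definition gfun :: "nat \<Rightarrow> Gam" where
  "gfun n = fps_nth (Gam_exp (Abs_fps (\<lambda>n. if odd n
     then Gam_const (2 * (qvar ^ n - 1) / of_nat n) * psum n else 0))) n"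

definition g_part :: "nat list \<Rightarrow> Gam" where
  "g_part ps = prod_list (map gfun ps)"

definition zeta :: "nat list \<Rightarrow> nat list \<Rightarrow> ratfun" where
  "zeta lam mu =
     Gam_form (g_part mu) (Qfun lam) / (2 ^ eps_part lam * (qvar - 1) ^ length mu)"


section \<open>Symmetric polynomials\<close>

text \<open>The indeterminate of integer polynomials is identified with \<open>qvar\<close>, so \<open>eval_int f qvar\<close>
  and \<open>eval_int f (inverse qvar)\<close> are \<open>f(q)\<close> and \<open>f(q\<^bsup>-1\<^esup>)\<close> in \<open>\<rat>(q)\<close>.\<close>

definition eval_int :: "int poly \<Rightarrow> ratfun \<Rightarrow> ratfun" where
  "eval_int f x = poly (map_poly of_int f) x"

definition symmetric_poly :: "int poly \<Rightarrow> bool" where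
  "symmetric_poly f \<longleftrightarrow> (\<exists>m::int. eval_int f qvar = qvar powi m * eval_int f (inverse qvar))"


section \<open>Checks on the definitions\<close>

definition monom_weight :: "monom_idx \<Rightarrow> nat" where
  "monom_weight m = (\<Sum>k\<in>Poly_Mapping.keys m. (2 * k + 1) * Poly_Mapping.lookup m k)"

lemma monom_weight_superset:
  assumes "finite A" "Poly_Mapping.keys m \<subseteq> A"
  shows "monom_weight m = (\<Sum>k\<in>A. (2 * k + 1) * Poly_Mapping.lookup m k)"
  unfolding monom_weight_def
  by (rule sum.mono_neutral_left) (use assms in \<open>auto simp: in_keys_iff\<close>)

lemma monom_weight_minus_single:
  assumes "Poly_Mapping.lookup m k \<noteq> 0"
  shows "monom_weight (m - Poly_Mapping.single k 1) + (2 * k + 1) = monom_weight m"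
proof -
  have k: "k \<in> Poly_Mapping.keys m"
    using assms by (simp add: in_keys_iff)
  have sub: "Poly_Mapping.keys (m - Poly_Mapping.single k 1) \<subseteq> Poly_Mapping.keys m"
    by (auto simp: in_keys_iff lookup_minus)
  have "monom_weight (m - Poly_Mapping.single k 1) =
      (\<Sum>i\<in>Poly_Mapping.keys m. (2 * i + 1) * Poly_Mapping.lookup (m - Poly_Mapping.single k 1) i)"
    by (rule monom_weight_superset[OF finite_keys sub])
  also have "\<dots> = (2 * k + 1) * (Poly_Mapping.lookup m k - 1) +
      (\<Sum>i\<in>Poly_Mapping.keys m - {k}. (2 * i + 1) * Poly_Mapping.lookup m i)"
    by (subst sum.remove[OF _ k])
       (auto simp: lookup_minus lookup_single when_def intro!: sum.cong)
  finally show ?thesis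
    unfolding monom_weight_def[of m] sum.remove[OF finite_keys k]
    using assms by (cases "Poly_Mapping.lookup m k") (auto simp: algebra_simps)
qed

lemma lookup_deriv_p_nonzero:
  assumes "odd n" "Poly_Mapping.lookup (deriv_p n f) m \<noteq> 0"
  shows "\<exists>m'. Poly_Mapping.lookup f m' \<noteq> 0 \<and> monom_weight m + n = monom_weight m'"
proof -
  have "(\<Sum>m'\<in>Poly_Mapping.keys f. Poly_Mapping.lookup
     (Poly_Mapping.single (m' - Poly_Mapping.single (n div 2) 1)
       (of_nat (Poly_Mapping.lookup m' (n div 2)) * Poly_Mapping.lookup f m')) m) \<noteq> 0"
    using assms(2) by (simp add: deriv_p_def lookup_sum)
  then obtain m' where m': "m' \<in> Poly_Mapping.keys f"
    "Poly_Mapping.lookup (Poly_Mapping.single (m' - Poly_Mapping.single (n div 2) 1)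
       (of_nat (Poly_Mapping.lookup m' (n div 2)) * Poly_Mapping.lookup f m')) m \<noteq> 0"
    by (meson sum.not_neutral_contains_not_neutral)
  then have "m = m' - Poly_Mapping.single (n div 2) 1" "Poly_Mapping.lookup m' (n div 2) \<noteq> 0"
    by (auto simp: lookup_single when_def split: if_splits)
  moreover have "2 * (n div 2) + 1 = n"
    using assms(1) by simp
  ultimately show ?thesis
    using m'(1) monom_weight_minus_single[of m' "n div 2"] by (metis in_keys_iff)
qed

lemma annihilation_log_weight:
  assumes "\<And>j m. Poly_Mapping.lookup (fps_nth F j) m \<noteq> 0 \<Longrightarrow> monom_weight m + j \<le> d"
    and "Poly_Mapping.lookup (fps_nth (annihilation_log F) j) m \<noteq> 0"
  shows "monom_weight m + j \<le> d"
proof -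
  have "(\<Sum>n\<in>{n. odd n \<and> n \<le> j}. Poly_Mapping.lookup (deriv_p n (fps_nth F (j - n))) m) \<noteq> 0"
    using assms(2) by (simp add: annihilation_log_def lookup_sum)
  then obtain n where n: "odd n" "n \<le> j" "Poly_Mapping.lookup (deriv_p n (fps_nth F (j - n))) m \<noteq> 0"
    by (metis (mono_tags, lifting) mem_Collect_eq sum.not_neutral_contains_not_neutral)
  from lookup_deriv_p_nonzero[OF n(1,3)] obtain m' where
    "Poly_Mapping.lookup (fps_nth F (j - n)) m' \<noteq> 0" "monom_weight m + n = monom_weight m'"
    by blast
  with assms(1)[of "j - n" m'] n(2) show ?thesis
    by simp
qed

lemma finite_annihilation: "finite {j. fps_nth (annihilation f) j \<noteq> 0}"
proof -
  define d where "d = Max (insert 0 (monom_weight ` Poly_Mapping.keys f))"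
  have d: "monom_weight m \<le> d" if "Poly_Mapping.lookup f m \<noteq> 0" for m
    unfolding d_def by (rule Max_ge) (use that in \<open>auto simp: in_keys_iff\<close>)
  have w: "monom_weight m + j \<le> d"
    if "Poly_Mapping.lookup (fps_nth ((annihilation_log ^^ k) (fps_const f)) j) m \<noteq> 0" for k j m
    using that
  proof (induction k arbitrary: j m)
    case 0
    then show ?case by (auto simp: d split: if_splits)
  next
    case (Suc k)
    show ?case
      by (rule annihilation_log_weight[OF Suc.IH]) (use Suc.prems in auto)
  qed
  have "fps_nth (annihilation f) j = 0" if "j > d" for j
  proof -
    have "fps_nth ((annihilation_log ^^ k) (fps_const f)) j = 0" for k
      using w[of k j] that by (intro poly_mapping_eqI) fastforce
    then show ?thesis by (simp add: annihilation_def)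
  qed
  then have "{j. fps_nth (annihilation f) j \<noteq> 0} \<subseteq> {..d}"
    by (force simp: not_less[symmetric])
  then show ?thesis
    by (rule finite_subset) simp
qed

lemma p_part_single:
  "p_part ps = Poly_Mapping.single (\<Sum>i\<leftarrow>ps. Poly_Mapping.single (i div 2) 1) 1"
  by (induction ps) (auto simp: p_part_def psum_def mult_single)

lemma lookup_exponents:
  fixes ps :: "nat list"
  assumes "\<forall>i\<in>set ps. odd i"
  shows "Poly_Mapping.lookup (\<Sum>i\<leftarrow>ps. Poly_Mapping.single (i div 2) (1::nat)) k =
    count_list ps (2 * k + 1)"
  using assms
proof (induction ps)
  case (Cons i ps)
  then obtain l where "i = 2 * l + 1" by (auto elim: oddE)
  then have "Poly_Mapping.lookup (Poly_Mapping.single (i div 2) (1::nat)) k =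
      (if i = 2 * k + 1 then 1 else 0)"
    by (simp add: lookup_single when_def)
  with Cons show ?case
    by (simp add: lookup_add)
qed simp

lemma keys_exponents:
  fixes ps :: "nat list"
  assumes "\<forall>i\<in>set ps. odd i"
  shows "bij_betw (\<lambda>k. 2 * k + 1)
    (Poly_Mapping.keys (\<Sum>i\<leftarrow>ps. Poly_Mapping.single (i div 2) (1::nat))) (set ps)"
proof -
  let ?e = "\<Sum>i\<leftarrow>ps. Poly_Mapping.single (i div 2) (1::nat)"
  have keys: "k \<in> Poly_Mapping.keys ?e \<longleftrightarrow> 2 * k + 1 \<in> set ps" for k
    unfolding in_keys_iff lookup_exponents[OF assms] count_list_0_iff by blast
  have "i \<in> (\<lambda>k. 2 * k + 1) ` Poly_Mapping.keys ?e" if "i \<in> set ps" for i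
  proof -
    from that assms have "odd i" by blast
    then obtain k where k: "i = 2 * k + 1" by (elim oddE)
    with that have "k \<in> Poly_Mapping.keys ?e" by (simp only: keys)
    with k show ?thesis by (rule image_eqI)
  qed
  then have "(\<lambda>k. 2 * k + 1) ` Poly_Mapping.keys ?e = set ps"
    using keys by blast
  moreover have "inj_on (\<lambda>k::nat. 2 * k + 1) (Poly_Mapping.keys ?e)"
    by (simp add: inj_on_def)
  ultimately show ?thesis
    unfolding bij_betw_def by blast
qed

lemma Gam_form_p_part:
  assumes "ps \<in> odd_partitions n" "rs \<in> odd_partitions n'"
  shows "Gam_form (p_part ps) (p_part rs) =
    (if ps = rs then of_nat (z_part ps) / 2 ^ length ps else 0)"
proof -
  let ?e = "\<lambda>ps. \<Sum>i\<leftarrow>ps. Poly_Mapping.single (i div 2) (1::nat)"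
  have odd: "\<forall>i\<in>set ps. odd i" "\<forall>i\<in>set rs. odd i"
    and sorted: "sorted_wrt (\<ge>) ps" "sorted_wrt (\<ge>) rs"
    using assms by (auto simp: odd_partitions_def)
  have inj: "ps = rs" if "?e ps = ?e rs"
  proof -
    have "count_list ps i = count_list rs i" for i
    proof (cases "odd i")
      case True
      then obtain k where "i = 2 * k + 1" by (elim oddE)
      with that show ?thesis
        using lookup_exponents[OF odd(1), of k] lookup_exponents[OF odd(2), of k] by simp
    next
      case False
      with odd have "i \<notin> set ps" "i \<notin> set rs" by auto
      then show ?thesis by (simp add: count_list_0_iff)
    qed
    then have "mset (rev ps) = mset (rev rs)"
      by (intro multiset_eqI) (simp add: count_mset)
    moreover have "sorted (rev ps)" "sorted (rev rs)"
      using sorted by (simp_all add: sorted_wrt_rev)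
    ultimately show ?thesis
      by (metis properties_for_sort rev_is_rev_conv)
  qed
  have "monom_length (?e ps) = (\<Sum>k\<in>Poly_Mapping.keys (?e ps). count_list ps (2 * k + 1))"
    by (simp only: monom_length_def lookup_exponents[OF odd(1)])
  also have "\<dots> = (\<Sum>i\<in>set ps. count_list ps i)"
    by (rule sum.reindex_bij_betw[OF keys_exponents[OF odd(1)]])
  finally have len: "monom_length (?e ps) = length ps"
    by (simp add: sum_count_set)
  have "monom_z (?e ps) = (\<Prod>k\<in>Poly_Mapping.keys (?e ps).
      (2 * k + 1) ^ count_list ps (2 * k + 1) * fact (count_list ps (2 * k + 1)))"
    by (simp only: monom_z_def lookup_exponents[OF odd(1)])
  also have "\<dots> = z_part ps"
    unfolding z_part_def by (rule prod.reindex_bij_betw[OF keys_exponents[OF odd(1)]])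
  finally have z: "monom_z (?e ps) = z_part ps" .
  have "Gam_form (p_part ps) (p_part rs) =
      (if ?e ps = ?e rs then of_nat (monom_z (?e ps)) / 2 ^ monom_length (?e ps) else 0)"
    unfolding Gam_form_def p_part_single by (simp add: lookup_single when_def)
  then show ?thesis
    using inj unfolding len z by metis
qed

end

theory Submission
  imports Defs
begin

text \<open>
  Write \<open>C(z) = \<Sum>\<^sub>n q\<^sub>n z\<^sup>n\<close> for the creation series and \<open>A(w) = \<Sum>\<^sub>j A\<^sub>j w\<^sup>j\<close> for the annihilation
  operator. \<open>A(w)\<close> is a ring homomorphism with \<open>A(w) C(z) = (1 - zw) / (1 + zw) C(z)\<close>, and
  multiplication by \<open>q\<^sub>n\<close> is adjoint to \<open>(-1)\<^sup>n A\<^sub>n\<close>. Hence the subring \<open>M\<close> of \<open>\<Gamma>\<close> generated by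
  the \<open>q\<^sub>n / 2\<close> with \<open>n > 0\<close> is stable under all \<open>A\<^sub>j\<close>, each vertex operator \<open>Q\<^sub>n\<close> with \<open>n > 0\<close>
  maps \<open>M\<close> into \<open>2M\<close>, so that \<open>Q\<^sub>\<lambda>\<close> lies in \<open>2\<^bsup>l(\<lambda>)\<^esup> M\<close>, and products of the \<open>q\<^sub>n\<close> pair
  integrally with \<open>M\<close>.

  On the other hand \<open>g\<^sub>n\<close> is the coefficient of \<open>z\<^sup>n\<close> in \<open>C(qz) C(-z)\<close>. As \<open>C(z) C(-z) = 1\<close>, it
  equals \<open>(q - 1) h\<^sub>n\<close> with \<open>h\<^sub>n = \<Sum>\<^sub>i (1 + q + \<dots> + q\<^bsup>i-1\<^esup>) (-1)\<^bsup>n-i\<^esup> q\<^sub>i q\<^bsub>n-i\<^esub>\<close> for \<open>n > 0\<close>, which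
  gives the integrality of \<open>\<zeta>\<close>. Exchanging \<open>i\<close> and \<open>n - i\<close> shows that \<open>q \<mapsto> q\<^sup>-\<^sup>1\<close> multiplies \<open>g\<^sub>n\<close>
  by \<open>(-q)\<^sup>-\<^sup>n\<close>, hence \<open>h\<^sub>n\<close> with \<open>n\<close> odd by \<open>q\<^bsup>1-n\<^esup>\<close>. To avoid this automorphism of \<open>\<rat>(q)\<close>,
  \<open>g\<^sub>n\<close> and \<open>h\<^sub>n\<close> are treated as functions of a parameter \<open>t \<in> \<rat>(q)\<close> that takes the values \<open>1\<close>,
  \<open>q\<close> and \<open>q\<^sup>-\<^sup>1\<close>.
\<close>

section \<open>The bilinear form and the partial derivatives\<close>

lemma Gam_const_0 [simp]: "Gam_const 0 = 0"
  and Gam_const_1 [simp]: "Gam_const 1 = 1"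
  and Gam_const_diff: "Gam_const (a - b) = Gam_const a - Gam_const b"
  and Gam_const_mult: "Gam_const (a * b) = Gam_const a * Gam_const b"
  by (simp_all add: Gam_const_def single_diff mult_single)

lemma Gam_const_of_nat: "Gam_const (of_nat n) = of_nat n"
  by (simp add: Gam_const_def)

lemma Gam_const_of_int: "Gam_const (of_int n) = of_int n"
  by (simp add: Gam_const_def)

lemma Gam_const_numeral: "Gam_const (numeral n) = numeral n"
  by (simp add: Gam_const_def)

lemma Gam_const_power: "Gam_const (a ^ n) = Gam_const a ^ n"
  by (induction n) (simp_all add: Gam_const_mult)

lemma Gam_const_half_mult: "2 * (Gam_const (1 / 2) * x) = x"
proof -
  have "2 * Gam_const (1 / 2) = Gam_const (2 * (1 / 2))"
    by (simp only: Gam_const_mult Gam_const_numeral)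
  then show ?thesis
    by (simp flip: mult.assoc)
qed

lemma of_nat_Gam_const_divide:
  assumes "n \<noteq> 0"
  shows "of_nat n * Gam_const (c / of_nat n) = Gam_const c"
  using assms by (simp flip: Gam_const_mult Gam_const_of_nat)

text \<open>Reduces additive identities, such as adjointness or the product rule, to single
  monomials; the zero element is the term with coefficient 0.\<close>

lemma Gam_induct [case_names single add]:
  assumes "\<And>m c. P (Poly_Mapping.single m c)" "\<And>f g. P f \<Longrightarrow> P g \<Longrightarrow> P (f + g)"
  shows "P (f :: Gam)"
proof -
  have "P (\<Sum>m\<in>A. Poly_Mapping.single m (Poly_Mapping.lookup f m))" if "finite A" for A
    using that
  proof (induction A rule: finite_induct)
    case empty
    show ?case using assms(1)[of 0 0] by simp
  qed (simp add: assms)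
  moreover have "f = (\<Sum>m\<in>Poly_Mapping.keys f. Poly_Mapping.single m (Poly_Mapping.lookup f m))"
    by (intro poly_mapping_eqI)
       (simp add: lookup_sum lookup_single when_def in_keys_iff sum.delta)
  ultimately show ?thesis
    by (metis finite_keys)
qed

section \<open>Length and norm of monomials under multiplication by a power sum\<close>

lemma monom_length_superset:
  assumes "finite A" "Poly_Mapping.keys m \<subseteq> A"
  shows "monom_length m = (\<Sum>k\<in>A. Poly_Mapping.lookup m k)"
  unfolding monom_length_def
  by (rule sum.mono_neutral_left) (use assms in \<open>auto simp: in_keys_iff\<close>)

lemma monom_z_superset:
  assumes "finite A" "Poly_Mapping.keys m \<subseteq> A"
  shows "monom_z m =
    (\<Prod>k\<in>A. (2 * k + 1) ^ Poly_Mapping.lookup m k * fact (Poly_Mapping.lookup m k))"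
  unfolding monom_z_def
  by (rule prod.mono_neutral_left) (use assms in \<open>auto simp: in_keys_iff\<close>)

lemma monom_length_plus_single:
  "monom_length (m + Poly_Mapping.single k 1) = Suc (monom_length m)"
proof -
  let ?A = "insert k (Poly_Mapping.keys m)" and ?m = "m + Poly_Mapping.single k 1"
  have "Poly_Mapping.keys ?m \<subseteq> ?A"
    using keys_add[of m "Poly_Mapping.single k 1"] by auto
  then have "monom_length ?m = (\<Sum>i\<in>?A. Poly_Mapping.lookup ?m i)"
    by (intro monom_length_superset) auto
  also have "\<dots> = (\<Sum>i\<in>?A. Poly_Mapping.lookup m i) + (\<Sum>i\<in>?A. if i = k then 1 else 0)"
    unfolding sum.distrib[symmetric]
    by (intro sum.cong) (auto simp: lookup_add lookup_single when_def)
  also have "(\<Sum>i\<in>?A. Poly_Mapping.lookup m i) = monom_length m"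
    by (intro monom_length_superset[symmetric]) auto
  finally show ?thesis
    by simp
qed

lemma monom_z_plus_single:
  "monom_z (m + Poly_Mapping.single k 1) =
    (2 * k + 1) * Suc (Poly_Mapping.lookup m k) * monom_z m"
proof -
  let ?A = "insert k (Poly_Mapping.keys m)" and ?m = "m + Poly_Mapping.single k 1"
  let ?w = "\<lambda>i e. (2 * i + 1) ^ e * fact e :: nat"
  have "Poly_Mapping.keys ?m \<subseteq> ?A"
    using keys_add[of m "Poly_Mapping.single k 1"] by auto
  then have "monom_z ?m = (\<Prod>i\<in>?A. ?w i (Poly_Mapping.lookup ?m i))"
    by (intro monom_z_superset) auto
  also have "\<dots> = (\<Prod>i\<in>?A. ?w i (Poly_Mapping.lookup m i)) *
      (\<Prod>i\<in>?A. if i = k then (2 * k + 1) * Suc (Poly_Mapping.lookup m k) else 1)"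
    unfolding prod.distrib[symmetric]
    by (intro prod.cong) (auto simp: lookup_add lookup_single when_def algebra_simps)
  also have "(\<Prod>i\<in>?A. ?w i (Poly_Mapping.lookup m i)) = monom_z m"
    by (intro monom_z_superset[symmetric]) auto
  finally show ?thesis
    by (simp add: prod.delta)
qed

section \<open>Bilinearity of the form, and constant terms\<close>

lemma Gam_form_superset:
  assumes "finite A" "Poly_Mapping.keys f \<subseteq> A"
  shows "Gam_form f g = (\<Sum>m\<in>A. Poly_Mapping.lookup f m * Poly_Mapping.lookup g m *
    (of_nat (monom_z m) / 2 ^ monom_length m))"
  unfolding Gam_form_def
  by (rule sum.mono_neutral_left) (use assms in \<open>auto simp: in_keys_iff\<close>)

lemma Gam_form_add_left: "Gam_form (f + f') g = Gam_form f g + Gam_form f' g"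
proof -
  let ?A = "Poly_Mapping.keys f \<union> Poly_Mapping.keys f'"
  have "Poly_Mapping.keys (f + f') \<subseteq> ?A"
    by (rule keys_add)
  then show ?thesis
    by (simp add: Gam_form_superset[of ?A] lookup_add algebra_simps sum.distrib
        add_divide_distrib)
qed

lemma Gam_form_add_right: "Gam_form f (g + g') = Gam_form f g + Gam_form f g'"
  unfolding Gam_form_def by (simp add: lookup_add algebra_simps sum.distrib add_divide_distrib)

lemma Gam_form_0_left [simp]: "Gam_form 0 g = 0"
  by (simp add: Gam_form_def)

lemma Gam_form_0_right [simp]: "Gam_form f 0 = 0"
  by (simp add: Gam_form_def)

lemma Gam_form_sum_left: "Gam_form (sum f A) g = (\<Sum>i\<in>A. Gam_form (f i) g)"
  by (induction A rule: infinite_finite_induct) (simp_all add: Gam_form_add_left)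

lemma Gam_form_sum_right: "Gam_form f (sum g A) = (\<Sum>i\<in>A. Gam_form f (g i))"
  by (induction A rule: infinite_finite_induct) (simp_all add: Gam_form_add_right)

lemma Gam_form_single:
  "Gam_form (Poly_Mapping.single m c) (Poly_Mapping.single m' c') =
    (if m = m' then c * c' * (of_nat (monom_z m) / 2 ^ monom_length m) else 0)"
  by (subst Gam_form_superset[of "{m}"]) (auto simp: lookup_single when_def)

lemma Gam_form_const_left: "Gam_form (Gam_const c * f) g = c * Gam_form f g"
proof (induction f rule: Gam_induct)
  case (single m a)
  show ?case
  proof (induction g rule: Gam_induct)
    case (single m' b)
    then show ?case by (simp add: Gam_const_def mult_single Gam_form_single)
  qed (simp add: Gam_form_add_right distrib_left)
qed (simp add: Gam_form_add_left distrib_left)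

lemma Gam_form_const_right: "Gam_form f (Gam_const c * g) = c * Gam_form f g"
proof (induction f rule: Gam_induct)
  case (single m a)
  show ?case
  proof (induction g rule: Gam_induct)
    case (single m' b)
    then show ?case by (simp add: Gam_const_def mult_single Gam_form_single)
  qed (simp add: Gam_form_add_right distrib_left)
qed (simp add: Gam_form_add_left distrib_left)

lemma Gam_form_1_left: "Gam_form 1 f = Poly_Mapping.lookup f 0"
proof -
  have "Gam_form 1 f = (\<Sum>m\<in>{0}. Poly_Mapping.lookup 1 m * Poly_Mapping.lookup f m *
      (of_nat (monom_z m) / 2 ^ monom_length m))"
    by (rule Gam_form_superset) simp_all
  then show ?thesis
    by (simp add: monom_z_def monom_length_def)
qed

lemma plus_eq_0_iff_monom: "a + b = 0 \<longleftrightarrow> a = 0 \<and> b = 0" for a b :: monom_idx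
  by (auto simp: poly_mapping_eq_iff lookup_add fun_eq_iff)

lemma lookup_mult_0:
  "Poly_Mapping.lookup (f * g) 0 = Poly_Mapping.lookup f 0 * Poly_Mapping.lookup g 0"
  for f g :: Gam
proof (induction f rule: Gam_induct)
  case (single m a)
  show ?case
  proof (induction g rule: Gam_induct)
    case (single m' b)
    then show ?case
      by (auto simp: mult_single lookup_single when_def plus_eq_0_iff_monom)
  qed (simp add: lookup_add distrib_left)
qed (simp add: lookup_add distrib_right)

section \<open>Partial derivatives, set to zero at even indices so that sums may run over whole
  intervals\<close>

definition odd_partial :: "nat \<Rightarrow> Gam \<Rightarrow> Gam" where
  "odd_partial n f = (if odd n then deriv_p n f else 0)"

lemma deriv_p_superset:
  assumes "finite A" "Poly_Mapping.keys f \<subseteq> A"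
  shows "deriv_p n f = (\<Sum>m\<in>A. Poly_Mapping.single (m - Poly_Mapping.single (n div 2) 1)
    (of_nat (Poly_Mapping.lookup m (n div 2)) * Poly_Mapping.lookup f m))"
  unfolding deriv_p_def
  by (rule sum.mono_neutral_left) (use assms in \<open>auto simp: in_keys_iff\<close>)

lemma odd_partial_add: "odd_partial n (f + g) = odd_partial n f + odd_partial n g"
proof -
  let ?A = "Poly_Mapping.keys f \<union> Poly_Mapping.keys g"
  have "Poly_Mapping.keys (f + g) \<subseteq> ?A"
    by (rule keys_add)
  then show ?thesis
    by (simp add: odd_partial_def deriv_p_superset[of ?A] lookup_add distrib_left single_add sum.distrib)
qed

lemma odd_partial_0 [simp]: "odd_partial n 0 = 0"
  by (simp add: odd_partial_def deriv_p_def)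

lemma odd_partial_sum: "odd_partial n (sum f A) = (\<Sum>i\<in>A. odd_partial n (f i))"
  by (induction A rule: infinite_finite_induct) (simp_all add: odd_partial_add)

lemma odd_partial_minus: "odd_partial n (- f) = - odd_partial n f"
  using odd_partial_add[of n f "- f"] by (simp add: eq_neg_iff_add_eq_0 add.commute)

lemma odd_partial_single:
  "odd_partial n (Poly_Mapping.single m c) = (if odd n then
     Poly_Mapping.single (m - Poly_Mapping.single (n div 2) 1)
       (of_nat (Poly_Mapping.lookup m (n div 2)) * c) else 0)"
  by (simp add: odd_partial_def deriv_p_superset[of "{m}"])

lemma odd_partial_mult: "odd_partial n (f * g) = odd_partial n f * g + f * odd_partial n g"
proof (induction f rule: Gam_induct)
  case (single m a)
  show ?case
  proof (induction g rule: Gam_induct)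
    case (single m' b)
    let ?e = "Poly_Mapping.single (n div 2) (1 :: nat)"
    \<comment> \<open>Subtraction of exponents is truncated, so it passes to one factor only if that
      factor contains the variable; otherwise the term has coefficient 0.\<close>
    have 1: "m + m' - ?e = m - ?e + m'" if "Poly_Mapping.lookup m (n div 2) \<noteq> 0"
      using that by (auto simp: poly_mapping_eq_iff fun_eq_iff lookup_add lookup_minus lookup_single when_def)
    have 2: "m + m' - ?e = m + (m' - ?e)" if "Poly_Mapping.lookup m' (n div 2) \<noteq> 0"
      using that by (auto simp: poly_mapping_eq_iff fun_eq_iff lookup_add lookup_minus lookup_single when_def)
    show ?case
      using 1 2 by (cases "Poly_Mapping.lookup m (n div 2) = 0";
          cases "Poly_Mapping.lookup m' (n div 2) = 0")
        (auto simp: odd_partial_single mult_single lookup_add algebra_simps simp flip: single_add)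
  qed (simp add: odd_partial_add algebra_simps)
qed (simp add: odd_partial_add algebra_simps)

lemma odd_partial_const [simp]: "odd_partial n (Gam_const c) = 0"
  by (simp add: odd_partial_single Gam_const_def)

lemma odd_partial_1 [simp]: "odd_partial n 1 = 0"
  using odd_partial_const[of n 1] by simp

lemma odd_partial_const_mult: "odd_partial n (Gam_const c * f) = Gam_const c * odd_partial n f"
  by (simp add: odd_partial_mult)

lemma odd_partial_of_nat_mult: "odd_partial n (of_nat k * f) = of_nat k * odd_partial n f"
  using odd_partial_const_mult[of n "of_nat k"] by (simp add: Gam_const_of_nat)

lemma odd_partial_commute: "odd_partial n (odd_partial k f) = odd_partial k (odd_partial n f)"
proof (induction f rule: Gam_induct)
  case (single m a)
  have "m - Poly_Mapping.single (n div 2) 1 - Poly_Mapping.single (k div 2) 1 =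
    m - Poly_Mapping.single (k div 2) 1 - Poly_Mapping.single (n div 2) 1"
    by (simp add: diff_diff_add add.commute)
  then show ?case
    by (cases "n div 2 = k div 2")
      (auto simp: odd_partial_single lookup_minus lookup_single when_def algebra_simps)
qed (simp add: odd_partial_add)

lemma odd_partial_psum:
  assumes "odd k"
  shows "odd_partial n (psum k) = (if n = k then 1 else 0)"
proof -
  have "n div 2 = k div 2 \<longleftrightarrow> n = k" if "odd n"
    using that assms by (metis odd_two_times_div_two_succ)
  then show ?thesis
    using assms by (auto simp: odd_partial_single psum_def lookup_single when_def)
qed

text \<open>Multiplication by \<open>p_k\<close> is adjoint to \<open>(k/2) d/dp_k\<close>: raising
  the exponent \<open>e\<close> of \<open>p_k\<close> by one multiplies the norm by
  \<open>k * (e + 1) / 2\<close>, and differentiation supplies the factor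
  \<open>e + 1\<close>.\<close>

lemma Gam_form_psum_mult:
  assumes "odd k"
  shows "2 * Gam_form (psum k * f) g = of_nat k * Gam_form f (odd_partial k g)"
proof (induction f rule: Gam_induct)
  case (single m a)
  show ?case
  proof (induction g rule: Gam_induct)
    case (single m' b)
    let ?e = "Poly_Mapping.single (k div 2) (1 :: nat)"
    have k: "2 * (k div 2) + 1 = k"
      using assms by simp
    show ?case
    proof (cases "Poly_Mapping.lookup m' (k div 2) = 0")
      case True
      then have "?e + m \<noteq> m'"
        by (metis add_is_0 lookup_add lookup_single_eq zero_neq_one)
      with True assms show ?thesis
        by (simp add: psum_def mult_single Gam_form_single odd_partial_single)
    next
      case False
      then have m': "m' = (m' - ?e) + ?e"
        by (auto simp: poly_mapping_eq_iff fun_eq_iff lookup_add lookup_minus lookup_single when_def)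
      then have eq: "?e + m = m' \<longleftrightarrow> m = m' - ?e"
        by (metis add.commute add_right_cancel)
      show ?thesis
      proof (cases "m = m' - ?e")
        case True
        then have "m' = m + ?e"
          using m' by simp
        with assms show ?thesis
          using monom_z_plus_single[of m "k div 2"] monom_length_plus_single[of m "k div 2"]
          unfolding k
          by (simp add: psum_def mult_single Gam_form_single odd_partial_single lookup_add add.commute
              field_simps)
      next
        case False
        with assms eq show ?thesis
          by (simp add: psum_def mult_single Gam_form_single odd_partial_single)
      qed
    qed
  qed (simp add: Gam_form_add_right odd_partial_add algebra_simps)
qed (simp add: Gam_form_add_left algebra_simps)


section \<open>The creation series and the annihilation operators\<close>

lemma fps_XD_mult: "fps_XD (a * b) = fps_XD a * b + a * fps_XD b"
  for a b :: "'a :: comm_ring_1 fps"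
  by (simp add: fps_XD_def algebra_simps)

lemma of_nat_Suc_inverse_fact:
  "of_nat (Suc n) * Gam_const (1 / fact (Suc n)) = Gam_const (1 / fact n)"
proof -
  have "of_nat (Suc n) * (1 / fact (Suc n)) = (1 / fact n :: ratfun)"
    by (simp only: fact_Suc) (simp del: of_nat_Suc)
  then show ?thesis
    by (metis Gam_const_of_nat Gam_const_mult)
qed

lemma fps_XD_Gam_exp:
  assumes "fps_nth L 0 = 0"
  shows "fps_XD (Gam_exp L) = fps_XD L * Gam_exp L"
proof -
  let ?E = "Abs_fps (\<lambda>k. Gam_const (1 / of_nat (fact k)))"
  have "fps_deriv ?E = ?E"
    by (intro fps_ext) (simp add: of_nat_Suc_inverse_fact del: fact_Suc of_nat_Suc)
  then show ?thesis
    unfolding Gam_exp_def fps_XD_def o_def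
    by (simp add: fps_compose_deriv[OF assms] mult_ac)
qed

lemma Gam_exp_nth_0 [simp]: "fps_nth (Gam_exp L) 0 = 1"
  by (simp add: Gam_exp_def)

text \<open>As \<open>L\<close> has no constant term, the coefficient of degree \<open>n\<close> in
  \<open>L * F\<close> involves only lower coefficients of \<open>F\<close>, and a factor
  \<open>n > 0\<close> can be cancelled.\<close>

lemma fps_XD_mult_unique:
  fixes F G L :: "Gam fps"
  assumes "fps_XD F = L * F" "fps_XD G = L * G" "fps_nth L 0 = 0" "fps_nth F 0 = fps_nth G 0"
  shows "F = G"
proof (rule fps_ext)
  fix n
  show "fps_nth F n = fps_nth G n"
  proof (induction n rule: less_induct)
    case (less n)
    show ?case
    proof (cases "n = 0")
      case False
      have "fps_nth L i * fps_nth F (n - i) = fps_nth L i * fps_nth G (n - i)" for i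
        using less[of "n - i"] False assms(3) by (cases "i = 0") auto
      then have "fps_nth (L * F) n = fps_nth (L * G) n"
        by (simp only: fps_mult_nth)
      then have "of_nat n * fps_nth F n = of_nat n * fps_nth G n"
        by (metis assms(1,2) fps_XD_nth)
      with False show ?thesis by simp
    qed (use assms in simp)
  qed
qed

section \<open>The coefficients \<open>q_n\<close> of the creation series\<close>

definition qcoeff :: "nat \<Rightarrow> Gam" where
  "qcoeff n = fps_nth creation n"

text \<open>The logarithmic derivative \<open>z C'(z) / C(z)\<close>: the Euler operator cancels the
  denominators \<open>n\<close> in the exponent of \<open>C(z)\<close>.\<close>

definition psum_series :: "Gam fps" where
  "psum_series = Abs_fps (\<lambda>k. if odd k then 2 * psum k else 0)"

lemma fps_XD_creation: "fps_XD creation = psum_series * creation"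
proof -
  have "of_nat n * (Gam_const (2 / of_nat n) * psum n) = 2 * psum n" if "odd n" for n
    using that of_nat_Gam_const_divide[of n 2]
    by (cases "n = 0") (simp_all add: Gam_const_numeral flip: mult.assoc)
  then have "fps_XD (Abs_fps (\<lambda>n. if odd n then Gam_const (2 / of_nat n) * psum n else 0)) =
      psum_series"
    by (intro fps_ext) (simp add: psum_series_def)
  then show ?thesis
    unfolding creation_def by (subst fps_XD_Gam_exp) simp_all
qed

lemma qcoeff_0 [simp]: "qcoeff 0 = 1"
  by (simp add: qcoeff_def creation_def)

lemma qcoeff_rec: "of_nat n * qcoeff n = (\<Sum>k\<le>n. (if odd k then 2 * psum k else 0) * qcoeff (n - k))"
proof -
  have "of_nat n * qcoeff n = fps_nth (psum_series * creation) n"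
    by (simp add: qcoeff_def flip: fps_XD_creation)
  then show ?thesis
    by (simp add: fps_mult_nth psum_series_def qcoeff_def atLeast0AtMost)
qed

lemma lookup_psum_0: "Poly_Mapping.lookup (psum n) 0 = 0"
proof -
  have "Poly_Mapping.single (n div 2) (1 :: nat) \<noteq> 0"
    by (metis lookup_single_eq lookup_zero one_neq_zero)
  then show ?thesis
    by (simp add: psum_def lookup_single when_def)
qed

lemma lookup_qcoeff_0:
  assumes "n > 0"
  shows "Poly_Mapping.lookup (qcoeff n) 0 = 0"
proof -
  have "Poly_Mapping.lookup (of_nat n * qcoeff n) 0 = 0"
    unfolding qcoeff_rec
    by (auto simp: lookup_sum lookup_mult_0 lookup_psum_0 intro!: sum.neutral)
  with assms show ?thesis
    by (simp add: lookup_mult_0 lookup_of_nat)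
qed

text \<open>For odd \<open>k\<close> this is \<open>k dC/dp_k = 2 z^k C(z)\<close>, as the exponent
  of \<open>C(z)\<close> contains \<open>(2/k) p_k z^k\<close>. Both sides solve the same
  inhomogeneous Euler equation, so their difference solves the homogeneous one and vanishes.\<close>

lemma odd_partial_qcoeff:
  "of_nat k * odd_partial k (qcoeff n) = (if odd k \<and> k \<le> n then 2 * qcoeff (n - k) else 0)"
proof (cases "odd k")
  case True
  have "fps_XD (Abs_fps (\<lambda>n. of_nat k * odd_partial k (qcoeff n))) =
     fps_const (2 * of_nat k) * fps_X ^ k * creation +
       psum_series * Abs_fps (\<lambda>n. of_nat k * odd_partial k (qcoeff n))"
    (is "fps_XD ?F = ?R + _")
  proof (rule fps_ext)
    fix n
    have "fps_nth (fps_XD ?F) n = of_nat k * odd_partial k (of_nat n * qcoeff n)"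
      by (simp add: odd_partial_of_nat_mult)
    also have "\<dots> = (\<Sum>i\<le>n. of_nat k * (odd_partial k (if odd i then 2 * psum i else 0) * qcoeff (n - i))) +
        (\<Sum>i\<le>n. (if odd i then 2 * psum i else 0) * (of_nat k * odd_partial k (qcoeff (n - i))))"
      unfolding qcoeff_rec odd_partial_sum odd_partial_mult sum_distrib_left sum.distrib[symmetric]
      by (intro sum.cong) (auto simp: algebra_simps)
    also have "(\<Sum>i\<le>n. of_nat k * (odd_partial k (if odd i then 2 * psum i else 0) * qcoeff (n - i))) =
        (\<Sum>i\<le>n. if i = k then of_nat k * (2 * qcoeff (n - k)) else 0)"
      using True odd_partial_of_nat_mult[of k 2]
      by (intro sum.cong) (auto simp: odd_partial_psum)
    also have "\<dots> = fps_nth ?R n"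
      by (auto simp: fps_X_power_mult_nth qcoeff_def mult.assoc not_le)
    finally show "fps_nth (fps_XD ?F) n = fps_nth (?R + psum_series * ?F) n"
      by (simp add: fps_mult_nth psum_series_def atLeast0AtMost)
  qed
  moreover have "fps_XD (fps_const 2 * fps_X ^ k * creation) =
    fps_const (2 * of_nat k) * fps_X ^ k * creation +
      psum_series * (fps_const 2 * fps_X ^ k * creation)"
  proof -
    have "fps_XD (fps_const (2 :: Gam) * fps_X ^ k) = fps_const (2 * of_nat k) * fps_X ^ k"
      by (intro fps_ext) (simp add: fps_X_power_nth)
    then show ?thesis
      unfolding fps_XD_mult[of "fps_const 2 * fps_X ^ k" creation] fps_XD_creation
      by (simp only: mult_ac)
  qed
  ultimately have 1: "fps_XD (?F - fps_const 2 * fps_X ^ k * creation) =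
      psum_series * (?F - fps_const 2 * fps_X ^ k * creation)"
    by (simp add: fps_XD_def algebra_simps)
  have 2: "fps_XD 0 = psum_series * 0" "fps_nth psum_series 0 = 0"
    by (simp_all add: fps_XD_def psum_series_def)
  have 3: "fps_nth (?F - fps_const 2 * fps_X ^ k * creation) 0 = fps_nth 0 0"
    using True by (cases "k = 0") simp_all
  have "?F - fps_const 2 * fps_X ^ k * creation = 0"
    by (rule fps_XD_mult_unique[OF 1 2 3])
  then have "?F = fps_const 2 * fps_X ^ k * creation"
    by simp
  then have "fps_nth ?F n = fps_nth (fps_const 2 * (fps_X ^ k * creation)) n"
    by (simp only: mult.assoc)
  with True show ?thesis
    by (auto simp: fps_X_power_mult_nth qcoeff_def)
qed (simp add: odd_partial_def)

section \<open>The operator \<open>annihilation_log\<close> and the Euler relation for its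
  exponential\<close>

lemma annihilation_log_nth:
  "fps_nth (annihilation_log F) j = - (\<Sum>n\<le>j. odd_partial n (fps_nth F (j - n)))"
proof -
  have "(\<Sum>n\<in>{n. odd n \<and> n \<le> j}. deriv_p n (fps_nth F (j - n))) =
      (\<Sum>n\<le>j. odd_partial n (fps_nth F (j - n)))"
    by (rule sum.mono_neutral_cong_left) (auto simp: odd_partial_def)
  then show ?thesis
    by (simp add: annihilation_log_def)
qed

lemma sum_simplex_swap:
  "(\<Sum>n\<le>j. \<Sum>m\<le>j - n. F n m) = (\<Sum>m\<le>j. \<Sum>n\<le>j - m. F n m)"
  for F :: "nat \<Rightarrow> nat \<Rightarrow> 'a :: comm_monoid_add"
proof -
  have "(\<Sum>n\<le>j. \<Sum>m\<le>j - n. F n m) = (\<Sum>n\<in>{..j}. \<Sum>m | m \<in> {..j} \<and> n + m \<le> j. F n m)"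
    by (intro sum.cong) auto
  also have "\<dots> = (\<Sum>m\<in>{..j}. \<Sum>n | n \<in> {..j} \<and> n + m \<le> j. F n m)"
    by (rule sum.swap_restrict) simp_all
  also have "\<dots> = (\<Sum>m\<le>j. \<Sum>n\<le>j - m. F n m)"
    by (intro sum.cong) auto
  finally show ?thesis .
qed

text \<open>
  This is \<open>w d/dw (T\<^sup>k\<^sup>+\<^sup>1) = (k + 1) (w dT/dw) T\<^sup>k\<close> for the operator \<open>T = annihilation_log\<close>, which
  holds because the partial derivatives commute.
\<close>

lemma annihilation_log_funpow_euler:
  "of_nat j * fps_nth ((annihilation_log ^^ Suc k) (fps_const f)) j =
    - of_nat (Suc k) * (\<Sum>n\<le>j. of_nat n *
      odd_partial n (fps_nth ((annihilation_log ^^ k) (fps_const f)) (j - n)))"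
proof (induction k arbitrary: j)
  case 0
  \<comment> \<open>The series \<open>fps_const f\<close> lives in degree 0, so only
    \<open>n = j\<close> contributes and the factor \<open>j\<close> may be read as
    \<open>n\<close>.\<close>
  have "of_nat j * odd_partial n (if j - n = 0 then f else 0) = of_nat n * odd_partial n (if j - n = 0 then f else 0)"
    if "n \<le> j" for n
    using that by (cases "n = j") auto
  then have "(\<Sum>n\<le>j. of_nat j * odd_partial n (if j - n = 0 then f else 0)) =
      (\<Sum>n\<le>j. of_nat n * odd_partial n (if j - n = 0 then f else 0))"
    by (intro sum.cong) auto
  then show ?case
    by (simp add: annihilation_log_nth sum_distrib_left sum_negf)
next
  case (Suc k)
  let ?t = "\<lambda>k. fps_nth ((annihilation_log ^^ k) (fps_const f))"
  let ?S = "\<Sum>n\<le>j. of_nat n * odd_partial n (?t (Suc k) (j - n))"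
  \<comment> \<open>Split \<open>j = n + (j - n)\<close>: the first summand has the required form,
    and the induction hypothesis rewrites the second.\<close>
  have "of_nat j * odd_partial n (?t (Suc k) (j - n)) =
      of_nat n * odd_partial n (?t (Suc k) (j - n)) -
        of_nat (Suc k) * (\<Sum>m\<le>j - n. of_nat m * odd_partial n (odd_partial m (?t k (j - n - m))))"
    if "n \<le> j" for n
  proof -
    have "of_nat j * odd_partial n (?t (Suc k) (j - n)) =
        of_nat n * odd_partial n (?t (Suc k) (j - n)) + odd_partial n (of_nat (j - n) * ?t (Suc k) (j - n))"
    proof -
      have "of_nat j = of_nat n + (of_nat (j - n) :: Gam)"
        using that by (simp flip: of_nat_add)
      then show ?thesis
        by (simp only: odd_partial_of_nat_mult distrib_right)
    qed
    also have "odd_partial n (of_nat (j - n) * ?t (Suc k) (j - n)) =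
        - of_nat (Suc k) * (\<Sum>m\<le>j - n. of_nat m * odd_partial n (odd_partial m (?t k (j - n - m))))"
      unfolding Suc.IH mult_minus_left odd_partial_minus odd_partial_of_nat_mult odd_partial_sum ..
    finally show ?thesis
      by (simp only: mult_minus_left add_uminus_conv_diff)
  qed
  then have "(\<Sum>n\<le>j. of_nat j * odd_partial n (?t (Suc k) (j - n))) =
      (\<Sum>n\<le>j. of_nat n * odd_partial n (?t (Suc k) (j - n))) -
      of_nat (Suc k) * (\<Sum>n\<le>j. \<Sum>m\<le>j - n. of_nat m * odd_partial n (odd_partial m (?t k (j - n - m))))"
    by (simp add: sum_subtractf sum_distrib_left)
  also have "(\<Sum>n\<le>j. \<Sum>m\<le>j - n. of_nat m * odd_partial n (odd_partial m (?t k (j - n - m)))) =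
      (\<Sum>m\<le>j. \<Sum>n\<le>j - m. of_nat m * odd_partial n (odd_partial m (?t k (j - n - m))))"
    by (rule sum_simplex_swap)
  \<comment> \<open>After the derivatives are commuted, the inner sum is, up to sign, the next power
    of \<open>annihilation_log\<close>.\<close>
  also have "\<dots> = (\<Sum>m\<le>j. of_nat m * odd_partial m (\<Sum>n\<le>j - m. odd_partial n (?t k (j - m - n))))"
    unfolding odd_partial_sum sum_distrib_left by (intro sum.cong refl, subst odd_partial_commute)
      (simp only: diff_commute)
  also have "\<dots> = - (\<Sum>m\<le>j. of_nat m * odd_partial m (?t (Suc k) (j - m)))"
    by (simp add: annihilation_log_nth odd_partial_minus sum_negf)
  finally have *: "(\<Sum>n\<le>j. of_nat j * odd_partial n (?t (Suc k) (j - n))) = ?S - of_nat (Suc k) * - ?S" .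
  have "of_nat j * ?t (Suc (Suc k)) j = - (\<Sum>n\<le>j. of_nat j * odd_partial n (?t (Suc k) (j - n)))"
    unfolding funpow.simps(2)[of "Suc k"] o_apply annihilation_log_nth mult_minus_right
      sum_distrib_left ..
  also have "\<dots> = - of_nat (Suc (Suc k)) * ?S"
  proof -
    have "- (S - c * - S) = - (1 + c) * S" for S c :: Gam
      by (simp add: algebra_simps)
    then show ?thesis
      unfolding * of_nat_Suc[of "Suc k"] .
  qed
  finally show ?case .
qed

definition annih :: "nat \<Rightarrow> Gam \<Rightarrow> Gam" where
  "annih j f = fps_nth (annihilation f) j"

lemma annih_0 [simp]: "annih 0 f = f"
  by (simp add: annih_def annihilation_def)

text \<open>Each application raises the order by at least one, as the summand \<open>n = 0\<close>
  is zero. Hence the exponential sum for the coefficient \<open>j\<close> may be cut off at any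
  \<open>N \<ge> j\<close>.\<close>

lemma annihilation_log_funpow_nth_eq_0:
  "j < k \<Longrightarrow> fps_nth ((annihilation_log ^^ k) (fps_const f)) j = 0"
proof (induction k arbitrary: j)
  case (Suc k)
  have "odd_partial n (fps_nth ((annihilation_log ^^ k) (fps_const f)) (j - n)) = 0" if "n \<le> j" for n
  proof (cases "n = 0")
    case False
    then show ?thesis
      using Suc.IH[of "j - n"] Suc.prems that by simp
  qed (simp add: odd_partial_def)
  then show ?case
    by (simp add: annihilation_log_nth)
qed simp

lemma annih_altdef:
  assumes "j \<le> N"
  shows "annih j f = (\<Sum>k\<le>N. Gam_const (1 / of_nat (fact k)) *
    fps_nth ((annihilation_log ^^ k) (fps_const f)) j)"
  unfolding annih_def annihilation_def fps_nth_Abs_fps using assms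
  by (intro sum.mono_neutral_left) (auto simp: annihilation_log_funpow_nth_eq_0)

text \<open>Divide the relation for the power \<open>k + 1\<close> by \<open>(k + 1)!\<close> and
  sum over \<open>k\<close>: the factor \<open>k + 1\<close> leaves \<open>1/k!\<close>, which
  rebuilds \<open>annih\<close> on the right.\<close>

lemma annih_euler: "of_nat j * annih j f = - (\<Sum>n\<le>j. of_nat n * odd_partial n (annih (j - n) f))"
proof -
  let ?t = "\<lambda>k. fps_nth ((annihilation_log ^^ k) (fps_const f))"
  let ?c = "\<lambda>k. Gam_const (1 / of_nat (fact k))"
  have c: "?c (Suc k) * of_nat (Suc k) = ?c k" for k
    using of_nat_Suc_inverse_fact[of k] by (simp only: of_nat_fact mult.commute)
  \<comment> \<open>The cut-off \<open>Suc j\<close> leaves the range up to \<open>j\<close> after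
    the shift; the split-off term \<open>k = 0\<close> lives in degree 0, where the factor
    \<open>j\<close> is zero.\<close>
  have "of_nat j * annih j f = (\<Sum>k\<le>Suc j. ?c k * (of_nat j * ?t k j))"
    by (simp add: annih_altdef[of j "Suc j"] sum_distrib_left algebra_simps del: sum.atMost_Suc)
  also have "\<dots> = ?c 0 * (of_nat j * ?t 0 j) + (\<Sum>k\<le>j. ?c (Suc k) * (of_nat j * ?t (Suc k) j))"
    by (rule sum.atMost_Suc_shift)
  also have "\<dots> = (\<Sum>k\<le>j. ?c (Suc k) * (of_nat j * ?t (Suc k) j))"
    by simp
  also have "\<dots> = (\<Sum>k\<le>j. - (?c k * (\<Sum>n\<le>j. of_nat n * odd_partial n (?t k (j - n)))))"
    unfolding annihilation_log_funpow_euler mult_minus_left mult_minus_right mult.assoc[symmetric] c ..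
  also have "\<dots> = - (\<Sum>k\<le>j. \<Sum>n\<le>j. of_nat n * odd_partial n (?c k * ?t k (j - n)))"
    by (simp add: sum_negf sum_distrib_left odd_partial_const_mult algebra_simps)
  also have "\<dots> = - (\<Sum>n\<le>j. of_nat n * odd_partial n (annih (j - n) f))"
    by (subst sum.swap) (simp add: annih_altdef[of _ j] odd_partial_sum sum_distrib_left)
  finally show ?thesis .
qed

text \<open>
  The relation \<open>w dA/dw = (w dT/dw) A\<close> determines \<open>A = exp T\<close>; all values of \<open>annih\<close> are computed
  from it.
\<close>

lemma annih_unique:
  assumes "a 0 = f"
    and "\<And>j. of_nat j * a j = - (\<Sum>n\<le>j. of_nat n * odd_partial n (a (j - n)))"
  shows "annih j f = a j"
proof (induction j rule: less_induct)
  case (less j)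
  show ?case
  proof (cases "j = 0")
    case False
    have "of_nat n * odd_partial n (annih (j - n) f) = of_nat n * odd_partial n (a (j - n))" for n
      using less[of "j - n"] False by (cases "n = 0") auto
    then have "of_nat j * annih j f = of_nat j * a j"
      by (simp only: annih_euler assms(2))
    with False show ?thesis by simp
  qed (simp add: assms(1))
qed

section \<open>The series \<open>A(w)\<close> as a ring homomorphism and its values on the
  \<open>q_n\<close>\<close>

lemma annih_add: "annih j (f + g) = annih j f + annih j g"
  by (rule annih_unique)
     (simp_all add: annih_euler[of _ f] annih_euler[of _ g] odd_partial_add distrib_left sum.distrib)

lemma annih_const: "annih j (Gam_const c) = (if j = 0 then Gam_const c else 0)"
  by (rule annih_unique) (auto intro!: sum.neutral)

text \<open>The exponential of a derivation is multiplicative: the Cauchy product satisfies the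
  Euler relation of \<open>annih_unique\<close>, because \<open>\<Sum> n w^n d/dp_n\<close> is a
  derivation.\<close>

lemma annih_mult: "annih j (f * g) = (\<Sum>i\<le>j. annih i f * annih (j - i) g)"
proof (rule annih_unique)
  fix j
  \<comment> \<open>This derivation is cut off at \<open>N\<close> and is exact in the coefficients
    up to \<open>N\<close>.\<close>
  let ?D = "\<lambda>N F. \<Sum>n\<le>N. fps_const (of_nat n) * (fps_X ^ n * Abs_fps (\<lambda>i. odd_partial n (fps_nth F i)))"
  have D_nth: "fps_nth (?D N F) i = (\<Sum>n\<le>i. of_nat n * odd_partial n (fps_nth F (i - n)))" if "i \<le> N" for N i F
  proof -
    have "fps_nth (?D N F) i = (\<Sum>n\<le>N. of_nat n * (if i < n then 0 else odd_partial n (fps_nth F (i - n))))"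
      by (simp add: fps_sum_nth fps_X_power_mult_nth cong: if_cong)
    also have "\<dots> = (\<Sum>n\<le>i. of_nat n * odd_partial n (fps_nth F (i - n)))"
      using that by (intro sum.mono_neutral_cong_right) auto
    finally show ?thesis .
  qed
  have D_mult: "?D N (F * G) = ?D N F * G + F * ?D N G" for N F G
  proof -
    have "Abs_fps (\<lambda>i. odd_partial n (fps_nth (F * G) i)) =
        Abs_fps (\<lambda>i. odd_partial n (fps_nth F i)) * G + F * Abs_fps (\<lambda>i. odd_partial n (fps_nth G i))" for n
      by (intro fps_ext) (simp add: fps_mult_nth odd_partial_sum odd_partial_mult sum.distrib)
    then show ?thesis
      by (simp add: sum_distrib_left sum_distrib_right sum.distrib algebra_simps)
  qed
  let ?A = "annihilation f" and ?B = "annihilation g"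
  have euler: "fps_nth (fps_XD (annihilation h)) i = - fps_nth (?D j (annihilation h)) i" if "i \<le> j" for h i
    using annih_euler[of i h] D_nth[OF that] by (simp add: annih_def)
  have "fps_nth (fps_XD (?A * ?B)) j = - fps_nth (?D j (?A * ?B)) j"
  proof -
    have "fps_nth (fps_XD ?A * ?B) j = - fps_nth (?D j ?A * ?B) j"
      unfolding fps_mult_nth[of _ ?B] sum_negf[symmetric]
      by (intro sum.cong refl, subst euler) auto
    moreover have "fps_nth (?A * fps_XD ?B) j = - fps_nth (?A * ?D j ?B) j"
      unfolding fps_mult_nth[of ?A] sum_negf[symmetric]
      by (intro sum.cong refl, subst euler) auto
    ultimately show ?thesis
      unfolding fps_XD_mult D_mult by (simp only: fps_add_nth minus_add_distrib)
  qed
  then show "of_nat j * (\<Sum>i\<le>j. annih i f * annih (j - i) g) =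
      - (\<Sum>n\<le>j. of_nat n * odd_partial n (\<Sum>i\<le>j - n. annih i f * annih (j - n - i) g))"
    unfolding fps_XD_nth D_nth[OF order_refl] by (simp only: fps_mult_nth annih_def atLeast0AtMost)
qed simp

text \<open>The coefficients of \<open>(1 - u) / (1 + u)\<close>.\<close>

definition cayley_coeff :: "nat \<Rightarrow> int" where
  "cayley_coeff j = (if j = 0 then 1 else 2 * (-1) ^ j)"

text \<open>This is \<open>u c'(u) = - (2u / (1 - u^2)) c(u)\<close> for
  \<open>c(u) = (1 - u) / (1 + u)\<close>.\<close>

lemma sum_cayley_coeff: "(\<Sum>n\<le>j. if odd n then 2 * cayley_coeff (j - n) else 0) = - (int j * cayley_coeff j)"
proof -
  have "(\<Sum>n\<le>j. if odd n then cayley_coeff (j - n) else 0) =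
      (if odd j then int j else - int j)"
  proof (induction j rule: induct_nat_012)
    case (ge2 n)
    have "(\<Sum>k\<le>Suc (Suc n). if odd k then cayley_coeff (Suc (Suc n) - k) else 0) =
      (\<Sum>k\<le>Suc n. if odd (Suc k) then cayley_coeff (Suc n - k) else 0)"
      by (simp add: sum.atMost_Suc_shift del: sum.atMost_Suc cong: if_cong)
    also have "\<dots> = cayley_coeff (Suc n) + (\<Sum>k\<le>n. if odd k then cayley_coeff (n - k) else 0)"
      by (simp add: sum.atMost_Suc_shift del: sum.atMost_Suc cong: if_cong)
    also have "\<dots> = (if odd (Suc (Suc n)) then int (Suc (Suc n)) else - int (Suc (Suc n)))"
      unfolding ge2 by (simp add: cayley_coeff_def)
    finally show ?case .
  qed (simp_all add: cayley_coeff_def)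
  then have "2 * (\<Sum>n\<le>j. if odd n then cayley_coeff (j - n) else 0) = - (int j * cayley_coeff j)"
    by (simp add: cayley_coeff_def)
  then show ?thesis
    by (simp add: sum_distrib_left if_distrib cong: if_cong)
qed

text \<open>Differentiation by \<open>p_n\<close> lowers the index of \<open>q\<close> by
  \<open>n\<close>, so every summand of the Euler relation is a multiple of \<open>q_(i-j)\<close>,
  and \<open>sum_cayley_coeff\<close> adds up the coefficients.\<close>

lemma annih_qcoeff: "annih j (qcoeff i) = (if j \<le> i then of_int (cayley_coeff j) * qcoeff (i - j) else 0)"
proof (rule annih_unique)
  fix j
  let ?a = "\<lambda>j. if j \<le> i then of_int (cayley_coeff j) * qcoeff (i - j) else 0"
  have odd_partial_int: "odd_partial n (of_int k * f) = of_int k * odd_partial n f" for n k f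
    using odd_partial_const_mult[of n "of_int k" f] by (simp add: Gam_const_of_int)
  have "of_nat n * odd_partial n (?a (j - n)) =
      (if j \<le> i then of_int (if odd n then 2 * cayley_coeff (j - n) else 0) * qcoeff (i - j) else 0)"
    if "n \<le> j" for n
  proof (cases "j - n \<le> i")
    case True
    have "of_nat n * odd_partial n (?a (j - n)) = of_int (cayley_coeff (j - n)) * (of_nat n * odd_partial n (qcoeff (i - (j - n))))"
      using True by (simp add: odd_partial_int)
    also have "\<dots> = of_int (cayley_coeff (j - n)) *
        (if odd n \<and> n \<le> i - (j - n) then 2 * qcoeff (i - (j - n) - n) else 0)"
      unfolding odd_partial_qcoeff ..
    also have "n \<le> i - (j - n) \<longleftrightarrow> j \<le> i"
      using True that by linarith
    also have "i - (j - n) - n = i - j"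
      using that by simp
    finally show ?thesis
      by simp
  qed (use that in auto)
  then have "(\<Sum>n\<le>j. of_nat n * odd_partial n (?a (j - n))) =
      (\<Sum>n\<le>j. if j \<le> i then of_int (if odd n then 2 * cayley_coeff (j - n) else 0) * qcoeff (i - j) else 0)"
    by (intro sum.cong) auto
  also have "\<dots> = (if j \<le> i then of_int (\<Sum>n\<le>j. if odd n then 2 * cayley_coeff (j - n) else 0) * qcoeff (i - j) else 0)"
    by (simp only: of_int_sum sum_distrib_right if_cancel split: if_split) simp
  finally show "of_nat j * ?a j = - (\<Sum>n\<le>j. of_nat n * odd_partial n (?a (j - n)))"
    unfolding sum_cayley_coeff by simp
qed (simp add: cayley_coeff_def)

section \<open>The adjoint of multiplication by \<open>q_n\<close>\<close>

lemma Gam_form_of_nat_left: "Gam_form (of_nat n * f) g = of_nat n * Gam_form f g"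
  using Gam_form_const_left[of "of_nat n"] by (simp add: Gam_const_of_nat)

lemma Gam_form_of_nat_right: "Gam_form f (of_nat n * g) = of_nat n * Gam_form f g"
  using Gam_form_const_right[of _ "of_nat n"] by (simp add: Gam_const_of_nat)

text \<open>Expand \<open>q_n\<close> by its recursion. The power sum is absorbed into
  \<open>f\<close>, which must therefore vary, and then crosses the form as a derivative;
  \<open>annih_euler\<close> collects the derivatives. Its minus sign matches
  \<open>(-1)^(n-k) = - (-1)^n\<close> for odd \<open>k\<close>.\<close>

lemma Gam_form_qcoeff_mult: "Gam_form (qcoeff n * f) g = (-1) ^ n * Gam_form f (annih n g)"
proof (induction n arbitrary: f rule: less_induct)
  case (less n)
  show ?case
  proof (cases "n = 0")
    case False
    have "Gam_form ((if odd k then 2 * psum k else 0) * qcoeff (n - k) * f) g =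
        (-1) ^ n * - (of_nat k * Gam_form f (odd_partial k (annih (n - k) g)))" if "k \<le> n" for k
    proof (cases "odd k")
      case True
      have "Gam_form (2 * psum k * qcoeff (n - k) * f) g = 2 * Gam_form (qcoeff (n - k) * (psum k * f)) g"
        using Gam_form_of_nat_left[of 2 "psum k * qcoeff (n - k) * f" g] by (simp add: mult_ac)
      also have "\<dots> = 2 * ((-1) ^ (n - k) * Gam_form (psum k * f) (annih (n - k) g))"
        using less[of "n - k" "psum k * f"] False True by (cases "k = 0") auto
      also have "\<dots> = (-1) ^ (n - k) * (of_nat k * Gam_form f (odd_partial k (annih (n - k) g)))"
        using Gam_form_psum_mult[OF True, of f "annih (n - k) g"] by (simp add: mult_ac)
      also have "(-1 :: ratfun) ^ (n - k) = - ((-1) ^ n)"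
        using True that by (cases "even n") auto
      finally show ?thesis
        using True by simp
    qed (simp add: odd_partial_def)
    then have "Gam_form (of_nat n * qcoeff n * f) g =
        (-1) ^ n * - (\<Sum>k\<le>n. of_nat k * Gam_form f (odd_partial k (annih (n - k) g)))"
      unfolding qcoeff_rec[of n] sum_distrib_right Gam_form_sum_left sum_negf[symmetric] sum_distrib_left
      by (intro sum.cong) auto
    also have "(\<Sum>k\<le>n. of_nat k * Gam_form f (odd_partial k (annih (n - k) g))) =
        Gam_form f (\<Sum>k\<le>n. of_nat k * odd_partial k (annih (n - k) g))"
      by (simp add: Gam_form_sum_right Gam_form_of_nat_right)
    also have "(\<Sum>k\<le>n. of_nat k * odd_partial k (annih (n - k) g)) = - (of_nat n * annih n g)"
      by (simp add: annih_euler[of n])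
    also have "Gam_form f (- (of_nat n * annih n g)) = - (of_nat n * Gam_form f (annih n g))"
      using Gam_form_const_right[of f "- of_nat n" "annih n g"]
      by (simp add: Gam_const_def single_uminus)
    finally have "of_nat n * Gam_form (qcoeff n * f) g = of_nat n * ((-1) ^ n * Gam_form f (annih n g))"
      by (simp add: Gam_form_of_nat_left mult.assoc mult.left_commute)
    with False show ?thesis by simp
  qed simp
qed


section \<open>Integrality and symmetry\<close>

inductive_set int_lattice :: "Gam set" where
  of_int: "of_int k \<in> int_lattice"
| half_qcoeff: "n > 0 \<Longrightarrow> Gam_const (1 / 2) * qcoeff n \<in> int_lattice"
| add: "f \<in> int_lattice \<Longrightarrow> g \<in> int_lattice \<Longrightarrow> f + g \<in> int_lattice"
| mult: "f \<in> int_lattice \<Longrightarrow> g \<in> int_lattice \<Longrightarrow> f * g \<in> int_lattice"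

lemma int_lattice_sum:
  "(\<And>i. i \<in> A \<Longrightarrow> f i \<in> int_lattice) \<Longrightarrow> sum f A \<in> int_lattice"
  using int_lattice.of_int[of 0]
  by (induction A rule: infinite_finite_induct) (auto intro: int_lattice.add)

lemma int_lattice_1: "1 \<in> int_lattice"
  using int_lattice.of_int[of 1] by simp

lemma int_lattice_qcoeff: "qcoeff n \<in> int_lattice"
proof (cases "n = 0")
  case False
  then have "of_int 2 * (Gam_const (1 / 2) * qcoeff n) \<in> int_lattice"
    by (intro int_lattice.mult int_lattice.of_int int_lattice.half_qcoeff) simp
  then show ?thesis
    by (simp add: Gam_const_half_mult)
qed (simp add: int_lattice_1)

lemma annih_const_mult: "annih j (Gam_const c * f) = Gam_const c * annih j f"
proof -
  have "annih j (Gam_const c * f) = (\<Sum>i\<le>j. if i = 0 then Gam_const c * annih j f else 0)"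
    unfolding annih_mult annih_const by (intro sum.cong) auto
  then show ?thesis
    by simp
qed

lemma int_lattice_annih: "f \<in> int_lattice \<Longrightarrow> annih j f \<in> int_lattice"
proof (induction arbitrary: j rule: int_lattice.induct)
  case (of_int k)
  show ?case
    using annih_const[of j "of_int k"] int_lattice.of_int[of k] int_lattice.of_int[of 0]
    by (auto simp: Gam_const_of_int)
next
  case (half_qcoeff n)
  consider "j = 0" | "0 < j" "j \<le> n" | "n < j"
    by linarith
  then show ?case
  proof cases
    case 1
    then show ?thesis
      using half_qcoeff by (simp add: int_lattice.half_qcoeff)
  next
    case 2
    \<comment> \<open>For \<open>j > 0\<close> the coefficient is \<open>2 * (-1)^j\<close>, and its
      2 cancels the half. This matters at \<open>j = n\<close>, as \<open>q_0 / 2 = 1/2\<close> is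
      not in the lattice.\<close>
    then have "annih j (Gam_const (1 / 2) * qcoeff n) =
        of_int ((-1) ^ j) * (2 * (Gam_const (1 / 2) * qcoeff (n - j)))"
      by (simp add: annih_const_mult annih_qcoeff cayley_coeff_def)
    then show ?thesis
      unfolding Gam_const_half_mult
      by (simp only: int_lattice.mult int_lattice.of_int int_lattice_qcoeff)
  next
    case 3
    then show ?thesis
      using int_lattice.of_int[of 0] by (simp add: annih_const_mult annih_qcoeff)
  qed
next
  case (add f g)
  then show ?case by (simp add: annih_add int_lattice.add)
next
  case (mult f g)
  then show ?case
    unfolding annih_mult by (intro int_lattice_sum int_lattice.mult) auto
qed

text \<open>The constant term is multiplicative and vanishes on each generator
  \<open>q_n / 2\<close>. As it is the pairing with 1, this starts the induction for the integral
  pairings.\<close>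

lemma int_lattice_lookup_0:
  "f \<in> int_lattice \<Longrightarrow> \<exists>k::int. Poly_Mapping.lookup f 0 = of_int k"
proof (induction rule: int_lattice.induct)
  case (of_int k)
  then show ?case
    by (auto simp: lookup_of_int)
next
  case (half_qcoeff n)
  then have "Poly_Mapping.lookup (Gam_const (1 / 2) * qcoeff n) 0 = of_int 0"
    by (simp add: lookup_mult_0 lookup_qcoeff_0)
  then show ?case by blast
next
  case (add f g)
  then show ?case by (metis lookup_add of_int_add)
next
  case (mult f g)
  then show ?case by (metis lookup_mult_0 of_int_mult)
qed

text \<open>As \<open>n + j > 0\<close>, every creation coefficient that occurs is twice a
  generator, so each vertex operator gains one factor 2.\<close>

lemma Qop_int_lattice:
  assumes "n > 0" "f \<in> int_lattice"
  shows "\<exists>g\<in>int_lattice. Qop (int n) (2 ^ l * f) = 2 ^ Suc l * g"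
proof -
  let ?J = "{j. fps_nth (annihilation (2 ^ l * f)) j \<noteq> 0 \<and> int n + int j \<ge> 0}"
  have "qcoeff (n + j) * annih j (2 ^ l * f) = 2 ^ Suc l * (Gam_const (1 / 2) * qcoeff (n + j) * annih j f)" for j
  proof -
    have "(2 :: Gam) ^ l = Gam_const (2 ^ l)"
      by (simp add: Gam_const_power Gam_const_numeral)
    then have "qcoeff (n + j) * annih j (2 ^ l * f) = 2 ^ l * (qcoeff (n + j) * annih j f)"
      by (simp only: annih_const_mult mult.left_commute)
    also have "\<dots> = 2 ^ l * (2 * (Gam_const (1 / 2) * qcoeff (n + j)) * annih j f)"
      by (simp only: Gam_const_half_mult)
    finally show ?thesis
      by (simp add: mult_ac)
  qed
  moreover have "nat (int n + int j) = n + j" for j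
    by simp
  ultimately have "Qop (int n) (2 ^ l * f) =
      2 ^ Suc l * (\<Sum>j\<in>?J. Gam_const (1 / 2) * qcoeff (n + j) * annih j f)"
    unfolding Qop_def qcoeff_def annih_def sum_distrib_left by (intro sum.cong) simp_all
  moreover have "(\<Sum>j\<in>?J. Gam_const (1 / 2) * qcoeff (n + j) * annih j f) \<in> int_lattice"
    using assms by (intro int_lattice_sum int_lattice.mult int_lattice.half_qcoeff int_lattice_annih) simp
  ultimately show ?thesis
    by blast
qed

lemma Qfun_int_lattice:
  "0 \<notin> set ps \<Longrightarrow> \<exists>f\<in>int_lattice. Qfun ps = 2 ^ length ps * f"
proof (induction ps)
  case Nil
  then show ?case
    using int_lattice_1 by (auto simp: Qfun_def)
next
  case (Cons n ps)
  then obtain f where f: "f \<in> int_lattice" "Qfun ps = 2 ^ length ps * f"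
    by auto
  have "Qfun (n # ps) = Qop (int n) (2 ^ length ps * f)"
    using f(2) by (simp add: Qfun_def)
  with Qop_int_lattice[OF _ f(1), of n "length ps"] Cons.prems show ?case
    by auto
qed

section \<open>The \<open>g_n\<close>, their quotients by \<open>t - 1\<close>, and the inversion of
  \<open>t\<close>\<close>

definition g_at :: "ratfun \<Rightarrow> nat \<Rightarrow> Gam" where
  "g_at t n = (\<Sum>i\<le>n. Gam_const (t ^ i * (-1) ^ (n - i)) * (qcoeff i * qcoeff (n - i)))"

text \<open>The geometric sum stands for \<open>(t^i - 1) / (t - 1)\<close> and is an integer
  polynomial in \<open>t\<close>.\<close>

definition h_at :: "ratfun \<Rightarrow> nat \<Rightarrow> Gam" where
  "h_at t n = (\<Sum>i\<le>n. Gam_const ((\<Sum>j<i. t ^ j) * (-1) ^ (n - i)) * (qcoeff i * qcoeff (n - i)))"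

definition fps_rescale :: "ratfun \<Rightarrow> Gam fps \<Rightarrow> Gam fps" where
  "fps_rescale c F = Abs_fps (\<lambda>n. Gam_const (c ^ n) * fps_nth F n)"

lemma fps_rescale_mult: "fps_rescale c (F * G) = fps_rescale c F * fps_rescale c G"
proof (rule fps_ext)
  fix n
  have "Gam_const (c ^ n) * (fps_nth F i * fps_nth G (n - i)) =
      Gam_const (c ^ i) * fps_nth F i * (Gam_const (c ^ (n - i)) * fps_nth G (n - i))"
    if "i \<in> {0..n}" for i
  proof -
    have "Gam_const (c ^ n) = Gam_const (c ^ i) * Gam_const (c ^ (n - i))"
      using that by (simp flip: Gam_const_mult power_add)
    then show ?thesis
      by (simp only: mult_ac)
  qed
  then show "fps_nth (fps_rescale c (F * G)) n = fps_nth (fps_rescale c F * fps_rescale c G) n"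
    by (simp only: fps_rescale_def fps_mult_nth fps_nth_Abs_fps sum_distrib_left cong: sum.cong)
qed

lemma fps_XD_rescale: "fps_XD (fps_rescale c F) = fps_rescale c (fps_XD F)"
  by (intro fps_ext) (simp add: fps_rescale_def mult.left_commute)

text \<open>\<open>C(tz) C(-z)\<close> and the exponential solve the same Euler equation, because
  \<open>t^n + (-1)^n = t^n - 1\<close> for odd \<open>n\<close>.\<close>

lemma g_at_series:
  "Abs_fps (g_at t) = Gam_exp (Abs_fps (\<lambda>n. if odd n
     then Gam_const (2 * (t ^ n - 1) / of_nat n) * psum n else 0))"
    (is "_ = Gam_exp ?L")
proof -
  let ?F = "fps_rescale t creation * fps_rescale (-1) creation"
  have F: "Abs_fps (g_at t) = ?F"
  proof (rule fps_ext)
    fix n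
    show "fps_nth (Abs_fps (g_at t)) n = fps_nth ?F n"
      by (simp add: g_at_def fps_mult_nth fps_rescale_def qcoeff_def atLeast0AtMost Gam_const_mult mult_ac)
  qed
  have L: "fps_XD ?L = fps_rescale t psum_series + fps_rescale (-1) psum_series"
  proof (rule fps_ext)
    fix n
    show "fps_nth (fps_XD ?L) n =
        fps_nth (fps_rescale t psum_series + fps_rescale (-1) psum_series) n"
    proof (cases "odd n")
      case True
      then have "n \<noteq> 0" by (cases n) auto
      have "of_nat n * (Gam_const (2 * (t ^ n - 1) / of_nat n) * psum n) =
          Gam_const (2 * (t ^ n - 1)) * psum n"
        unfolding mult.assoc[symmetric] of_nat_Gam_const_divide[OF \<open>n \<noteq> 0\<close>] ..
      also have "\<dots> = Gam_const (t ^ n) * (2 * psum n) + Gam_const ((-1) ^ n) * (2 * psum n)"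
        using True by (simp add: Gam_const_mult Gam_const_diff Gam_const_numeral Gam_const_def[of "-1"]
          single_uminus algebra_simps)
      finally show ?thesis
        using True by (simp add: fps_rescale_def psum_series_def)
    qed (simp add: fps_rescale_def psum_series_def)
  qed
  have "fps_XD ?F = fps_XD ?L * ?F"
    unfolding L fps_XD_mult fps_XD_rescale fps_XD_creation fps_rescale_mult
    by (simp only: algebra_simps)
  moreover have "fps_XD (Gam_exp ?L) = fps_XD ?L * Gam_exp ?L"
    by (rule fps_XD_Gam_exp) simp
  moreover have "fps_nth (fps_XD ?L) 0 = 0"
    by simp
  moreover have "fps_nth ?F 0 = fps_nth (Gam_exp ?L) 0"
    by (simp add: fps_rescale_def creation_def)
  ultimately have "?F = Gam_exp ?L"
    by (rule fps_XD_mult_unique)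
  with F show ?thesis by simp
qed

lemma gfun_eq_g_at: "gfun n = g_at qvar n"
  unfolding gfun_def g_at_series[symmetric] by simp

text \<open>This is \<open>C(z) C(-z) = 1\<close>: at \<open>t = 1\<close> the exponent is
  zero.\<close>

lemma g_at_1_eq_0:
  assumes "n > 0"
  shows "g_at 1 n = 0"
proof -
  have "Abs_fps (\<lambda>n. if odd n then Gam_const (2 * (1 ^ n - 1) / of_nat n) * psum n else 0) = 0"
    by (intro fps_ext) simp
  then have "fps_nth (Abs_fps (g_at 1)) n = fps_nth (Gam_exp 0) n"
    by (simp only: g_at_series)
  with assms show ?thesis
    by (simp add: Gam_exp_def)
qed

lemma g_at_eq_h_at:
  assumes "n > 0"
  shows "g_at t n = Gam_const (t - 1) * h_at t n"
proof -
  have "g_at t n = g_at t n - g_at 1 n"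
    by (simp add: g_at_1_eq_0[OF assms])
  also have "\<dots> = (\<Sum>i\<le>n. Gam_const ((t ^ i - 1) * (-1) ^ (n - i)) * (qcoeff i * qcoeff (n - i)))"
    unfolding g_at_def sum_subtractf[symmetric] left_diff_distrib[symmetric] Gam_const_diff[symmetric]
    by simp
  also have "\<dots> = Gam_const (t - 1) * h_at t n"
    unfolding h_at_def sum_distrib_left[of "Gam_const (t - 1)"]
    by (simp only: power_diff_1_eq Gam_const_mult mult.assoc)
  finally show ?thesis .
qed

text \<open>In terms of series, \<open>C(z/t) C(-z)\<close> is \<open>C(tu) C(-u)\<close> at
  \<open>u = -z/t\<close>; on coefficients this is the reflection of \<open>i\<close> to
  \<open>n - i\<close>.\<close>

lemma g_at_inverse:
  assumes "t \<noteq> 0"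
  shows "g_at (inverse t) n = Gam_const ((- inverse t) ^ n) * g_at t n"
proof -
  have *: "inverse t ^ (n - i) * (-1) ^ i = (- inverse t) ^ n * (t ^ i * (-1) ^ (n - i))" if "i \<le> n" for i
  proof -
    have "(- inverse t) ^ n = (- inverse t) ^ i * (- inverse t) ^ (n - i)"
      using that by (simp flip: power_add)
    also have "\<dots> = (-1) ^ i * inverse t ^ i * ((-1) ^ (n - i) * inverse t ^ (n - i))"
      by (simp add: power_minus[of "inverse t"])
    finally have "(- inverse t) ^ n * (t ^ i * (-1) ^ (n - i)) =
        (inverse t ^ i * t ^ i) * ((-1) ^ (n - i) * (-1) ^ (n - i)) * (inverse t ^ (n - i) * (-1) ^ i)"
      by (simp only: mult_ac)
    moreover have "inverse t ^ i * t ^ i = 1"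
      using assms by (simp flip: power_mult_distrib)
    moreover have "(-1 :: ratfun) ^ (n - i) * (-1) ^ (n - i) = 1"
      by (simp flip: power_mult_distrib)
    ultimately show ?thesis
      by simp
  qed
  have "g_at (inverse t) n =
      (\<Sum>i\<le>n. Gam_const (inverse t ^ (n - i) * (-1) ^ i) * (qcoeff i * qcoeff (n - i)))"
    unfolding g_at_def
    by (rule sum.reindex_bij_witness[of _ "\<lambda>i. n - i" "\<lambda>i. n - i"]) (auto simp: mult_ac)
  also have "\<dots> = Gam_const ((- inverse t) ^ n) * g_at t n"
    unfolding g_at_def sum_distrib_left
    by (intro sum.cong refl) (simp only: atMost_iff * Gam_const_mult mult.assoc)
  finally show ?thesis .
qed

lemma h_at_inverse:
  assumes "t \<noteq> 0" "t \<noteq> 1" "odd n"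
  shows "h_at (inverse t) n = Gam_const (inverse t ^ (n - 1)) * h_at t n"
proof -
  have n: "n > 0"
    using assms(3) by (cases n) auto
  let ?c = "inverse t - 1"
  have c: "?c \<noteq> 0"
    using assms by (simp add: field_simps)
  have "Gam_const ?c * h_at (inverse t) n = Gam_const ((- inverse t) ^ n * (t - 1)) * h_at t n"
    using g_at_inverse[OF assms(1), of n] by (simp add: g_at_eq_h_at[OF n] Gam_const_mult mult_ac)
  \<comment> \<open>For odd \<open>n\<close> the sign is -1, and
    \<open>-(t - 1) / t = 1/t - 1\<close> uses up one of the \<open>n\<close> factors
    \<open>1/t\<close>.\<close>
  also have "(- inverse t) ^ n * (t - 1) = ?c * inverse t ^ (n - 1)"
    using assms n by (cases n) (auto simp: field_simps)
  finally have "Gam_const (inverse ?c) * Gam_const ?c * h_at (inverse t) n =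
      Gam_const (inverse ?c) * Gam_const ?c * (Gam_const (inverse t ^ (n - 1)) * h_at t n)"
    by (simp only: Gam_const_mult mult.assoc)
  moreover have "Gam_const (inverse ?c) * Gam_const ?c = 1"
    using c by (simp flip: Gam_const_mult)
  ultimately show ?thesis
    by (simp only: mult_1)
qed

lemma prod_h_at_inverse:
  assumes "t \<noteq> 0" "t \<noteq> 1" "\<forall>n\<in>set ns. odd n"
  shows "\<exists>k. prod_list (map (h_at (inverse t)) ns) = Gam_const (inverse t ^ k) * prod_list (map (h_at t) ns)"
  using assms(3)
proof (induction ns)
  case Nil
  have "prod_list (map (h_at (inverse t)) []) = Gam_const (inverse t ^ 0) * prod_list (map (h_at t) [])"
    by simp
  then show ?case by blast
next
  case (Cons n ns)
  then obtain k where "prod_list (map (h_at (inverse t)) ns) = Gam_const (inverse t ^ k) * prod_list (map (h_at t) ns)"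
    by auto
  with Cons.prems have "prod_list (map (h_at (inverse t)) (n # ns)) =
      Gam_const (inverse t ^ (n - 1 + k)) * prod_list (map (h_at t) (n # ns))"
    by (simp add: h_at_inverse[OF assms(1,2)] power_add Gam_const_mult mult_ac)
  then show ?case by blast
qed

lemma g_part_eq_h_at:
  assumes "\<forall>n\<in>set ns. odd n"
  shows "g_part ns = Gam_const ((qvar - 1) ^ length ns) * prod_list (map (h_at qvar) ns)"
  using assms
proof (induction ns)
  case (Cons n ns)
  then have "n > 0" by (cases n) auto
  with Cons show ?case
    by (simp add: g_part_def gfun_eq_g_at g_at_eq_h_at Gam_const_mult mult_ac)
qed (simp add: g_part_def)

section \<open>Evaluation of integer polynomials and integral pairings\<close>

lemma eval_int_pCons: "eval_int (pCons a p) t = of_int a + t * eval_int p t"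
  by (simp add: eval_int_def map_poly_pCons)

lemma eval_int_0 [simp]: "eval_int 0 t = 0"
  by (simp add: eval_int_def)

lemma eval_int_const: "eval_int [:c:] t = of_int c"
  by (simp add: eval_int_pCons)

lemma eval_int_add: "eval_int (p + r) t = eval_int p t + eval_int r t"
  by (induction p r rule: poly_induct2) (simp_all add: eval_int_pCons algebra_simps)

lemma eval_int_smult: "eval_int (smult c p) t = of_int c * eval_int p t"
  by (induction p) (simp_all add: eval_int_pCons algebra_simps)

lemma eval_int_mult: "eval_int (p * r) t = eval_int p t * eval_int r t"
  by (induction p) (simp_all add: eval_int_pCons eval_int_add eval_int_smult algebra_simps)

lemma eval_int_sum: "eval_int (sum p A) t = (\<Sum>i\<in>A. eval_int (p i) t)"
  by (induction A rule: infinite_finite_induct) (simp_all add: eval_int_add)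

lemma eval_int_monom: "eval_int (monom 1 n) t = t ^ n"
  by (induction n) (simp_all add: monom_0 monom_Suc eval_int_pCons)

text \<open>
  The polynomial must not depend on \<open>t\<close>: evaluating it at \<open>q\<close> and at \<open>q\<^sup>-\<^sup>1\<close> then compares
  \<open>\<zeta>(q)\<close> with \<open>\<zeta>(q\<^sup>-\<^sup>1)\<close>.
\<close>

definition int_pairing :: "(ratfun \<Rightarrow> Gam) \<Rightarrow> bool" where
  "int_pairing x \<longleftrightarrow> (\<forall>f\<in>int_lattice. \<exists>p. \<forall>t. Gam_form (x t) f = eval_int p t)"

lemma int_pairing_1: "int_pairing (\<lambda>_. 1)"
  unfolding int_pairing_def Gam_form_1_left
  by (metis eval_int_const int_lattice_lookup_0)

text \<open>Adjointness moves \<open>q_n\<close> to the other argument, where \<open>annih n\<close>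
  preserves the lattice.\<close>

lemma int_pairing_qcoeff_mult:
  assumes "int_pairing x"
  shows "int_pairing (\<lambda>t. qcoeff n * x t)"
  unfolding int_pairing_def
proof
  fix f assume "f \<in> int_lattice"
  then obtain p where "\<forall>t. Gam_form (x t) (annih n f) = eval_int p t"
    using assms int_lattice_annih unfolding int_pairing_def by blast
  then have "\<forall>t. Gam_form (qcoeff n * x t) f = eval_int (smult ((-1) ^ n) p) t"
    by (simp add: Gam_form_qcoeff_mult eval_int_smult)
  then show "\<exists>p. \<forall>t. Gam_form (qcoeff n * x t) f = eval_int p t" ..
qed

lemma int_pairing_const_mult:
  assumes "int_pairing x"
  shows "int_pairing (\<lambda>t. Gam_const (eval_int r t) * x t)"
  using assms unfolding int_pairing_def Gam_form_const_left by (metis eval_int_mult)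

lemma int_pairing_sum:
  assumes "\<And>i. i \<in> A \<Longrightarrow> int_pairing (x i)"
  shows "int_pairing (\<lambda>t. \<Sum>i\<in>A. x i t)"
  unfolding int_pairing_def
proof
  fix f assume "f \<in> int_lattice"
  then have "\<forall>i\<in>A. \<exists>p. \<forall>t. Gam_form (x i t) f = eval_int p t"
    using assms unfolding int_pairing_def by blast
  then obtain p where "\<forall>i\<in>A. \<forall>t. Gam_form (x i t) f = eval_int (p i) t"
    by metis
  then have "\<forall>t. Gam_form (\<Sum>i\<in>A. x i t) f = eval_int (sum p A) t"
    by (simp add: Gam_form_sum_left eval_int_sum)
  then show "\<exists>p. \<forall>t. Gam_form (\<Sum>i\<in>A. x i t) f = eval_int p t" ..
qed

lemma int_pairing_h_at_mult:
  assumes "int_pairing x"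
  shows "int_pairing (\<lambda>t. h_at t n * x t)"
proof -
  have "h_at t n * x t = (\<Sum>i\<le>n. Gam_const (eval_int (smult ((-1) ^ (n - i)) (\<Sum>j<i. monom 1 j)) t) *
      (qcoeff i * (qcoeff (n - i) * x t)))" for t
  proof -
    have "(\<Sum>i\<le>n. Gam_const (a i) * (qcoeff i * qcoeff (n - i))) * y =
        (\<Sum>i\<le>n. Gam_const (a i) * (qcoeff i * (qcoeff (n - i) * y)))" for a y
      unfolding sum_distrib_right by (simp only: mult.assoc)
    moreover have "eval_int (smult ((-1) ^ k) (\<Sum>j<i. monom 1 j)) t = (\<Sum>j<i. t ^ j) * (-1) ^ k" for i k
      by (simp add: eval_int_smult eval_int_sum eval_int_monom mult.commute)
    ultimately show ?thesis
      by (simp only: h_at_def)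
  qed
  then show ?thesis
    by (simp only: int_pairing_sum int_pairing_const_mult int_pairing_qcoeff_mult assms)
qed

lemma int_pairing_prod_h_at: "int_pairing (\<lambda>t. prod_list (map (h_at t) ns))"
  by (induction ns) (simp_all add: int_pairing_1 int_pairing_h_at_mult)

section \<open>The character values\<close>

lemma qvar_neq_0: "qvar \<noteq> 0" and qvar_neq_1: "qvar \<noteq> 1"
  by (simp_all add: qvar_def Zero_fract_def One_fract_def eq_fract one_pCons)

theorem theorem2p13:
  fixes n :: nat and lam mu :: "nat list"
  assumes "lam \<in> strict_partitions n" and "mu \<in> odd_partitions n"
  shows "\<exists>f :: int poly. zeta lam mu = eval_int f qvar \<and> symmetric_poly f"
proof -
  have "0 \<notin> set lam" and odd: "\<forall>i\<in>set mu. odd i"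
    using assms by (simp_all add: strict_partitions_def odd_partitions_def)
  then obtain x where x: "x \<in> int_lattice" "Qfun lam = 2 ^ length lam * x"
    using Qfun_int_lattice by blast
  let ?h = "\<lambda>t. prod_list (map (h_at t) mu)"
  obtain p where p: "Gam_form (?h t) x = eval_int p t" for t
    using int_pairing_prod_h_at[of mu] x(1) unfolding int_pairing_def by blast
  \<comment> \<open>\<open>Qfun lam\<close> contributes \<open>2 ^ length lam\<close>, of which
    \<open>zeta\<close> divides out \<open>2 ^ eps_part lam\<close>.\<close>
  define f where "f = smult (2 ^ (length lam - eps_part lam)) p"
  have "Qfun lam = Gam_const (2 ^ length lam) * x"
    by (simp add: x(2) Gam_const_power Gam_const_numeral)
  then have "Gam_form (g_part mu) (Qfun lam) =
      (qvar - 1) ^ length mu * (2 ^ length lam * eval_int p qvar)"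
    by (simp only: g_part_eq_h_at[OF odd] Gam_form_const_left Gam_form_const_right p mult.left_commute)
  moreover have "(2 :: ratfun) ^ length lam =
      2 ^ (length lam - eps_part lam) * 2 ^ eps_part lam"
    by (simp add: eps_part_def flip: power_add)
  ultimately have "zeta lam mu = eval_int f qvar"
    using qvar_neq_1 by (simp add: zeta_def f_def eval_int_smult)
  moreover obtain k where "?h (inverse qvar) = Gam_const (inverse qvar ^ k) * ?h qvar"
    using prod_h_at_inverse[OF qvar_neq_0 qvar_neq_1 odd] by blast
  then have "eval_int p (inverse qvar) = inverse qvar ^ k * eval_int p qvar"
    by (simp only: Gam_form_const_left flip: p)
  \<comment> \<open>Inverting \<open>q\<close> multiplies \<open>f\<close> by \<open>q^(-k)\<close>,
    so the exponent of the symmetry is \<open>k\<close>.\<close>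
  then have "eval_int f qvar = qvar powi int k * eval_int f (inverse qvar)"
    using qvar_neq_0 by (simp add: f_def eval_int_smult power_inverse field_simps)
  ultimately show ?thesis
    unfolding symmetric_poly_def by blast
qed

end
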